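(* Let $R$ be a finite non-local commutative ring with non-zero identity. Then the Jacobson graph $\mathfrak{J}_R$ is Hamiltonian if and only if it is pancyclic.
   Context: All rings are commutative with a non-zero identity. For a ring $R$, $J(R)$ denotes its Jacobson radical and $U(R)$ its group of units. The Jacobson graph $\mathfrak{J}_R$ of $R$ is the simple graph with vertex set $R\setminus J(R)$ in which two distinct vertices $x,y$ are adjacent if and only if $1-xy\notin U(R)$. A graph is Hamiltonian if it has a Hamiltonian cycle, i.e. a cycle (of length at least 3) including all the vertices of the graph. A graph $G$ is pancyclic if it contains cycles of length $l$ for each $3\leq l\leq|V(G)|$. *)

theory Defs
  imports "HOL-Algebra.Algebra" "Graph_Theory.Graph_Theory"
begin

definition local_ring :: "('a, 'b) ring_scheme \<Rightarrow> bool" where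
  "local_ring R \<longleftrightarrow> cring R \<and> (\<exists>!M. maximalideal M R)"

definition jacobson_radical :: "('a, 'b) ring_scheme \<Rightarrow> 'a set" where
  "jacobson_radical R = {x \<in> carrier R. \<forall>M. maximalideal M R \<longrightarrow> x \<in> M}"

text \<open>
  Simple graphs are represented, as in the session \<open>Graph_Theory\<close>, by symmetric loop-free
  pair digraphs (locale \<^locale>\<open>pair_graph\<close>): an edge is a pair of opposite arcs.
\<close>

definition jacobson_graph :: "('a, 'b) ring_scheme \<Rightarrow> 'a pair_pre_digraph" where
  "jacobson_graph R =
    \<lparr> pverts = carrier R - jacobson_radical R,
      parcs = {(x, y). x \<in> carrier R - jacobson_radical R \<and> y \<in> carrier R - jacobson_radical R
        \<and> x \<noteq> y \<and> \<one>\<^bsub>R\<^esub> \<ominus>\<^bsub>R\<^esub> (x \<otimes>\<^bsub>R\<^esub> y) \<notin> Units R} \<rparr>"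

lemma pair_graph_jacobson_graph:
  assumes "cring R" and "finite (carrier R)"
  shows "pair_graph (jacobson_graph R)"
proof -
  interpret cring R by fact
  have "parcs (jacobson_graph R) \<subseteq> carrier R \<times> carrier R"
    by (auto simp: jacobson_graph_def)
  then have "finite (parcs (jacobson_graph R))"
    using assms(2) finite_subset by blast
  then show ?thesis
    using assms(2)
    by unfold_locales (auto simp: jacobson_graph_def symmetric_def sym_def m_comm)
qed

text \<open>
  A cycle is a list of arcs. The library's \<^const>\<open>pre_digraph.cycle\<close> also admits the closed
  walk of length 2 that traverses one edge back and forth, hence the bound on the length.
\<close>

definition graph_cycle :: "'a pair_pre_digraph \<Rightarrow> ('a \<times> 'a) list \<Rightarrow> bool" where
  "graph_cycle G p \<longleftrightarrow> pre_digraph.cycle (with_proj G) p \<and> 3 \<le> length p"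

definition hamiltonian :: "'a pair_pre_digraph \<Rightarrow> bool" where
  "hamiltonian G \<longleftrightarrow> (\<exists>p. graph_cycle G p \<and> fst ` set p = pverts G)"

definition pancyclic :: "'a pair_pre_digraph \<Rightarrow> bool" where
  "pancyclic G \<longleftrightarrow>
    (\<forall>l. 3 \<le> l \<and> l \<le> card (pverts G) \<longrightarrow> (\<exists>p. graph_cycle G p \<and> length p = l))"

end

theory Submission
  imports Defs
begin

text \<open>
  Vertices \<open>x\<close>, \<open>y\<close> are adjacent iff \<open>x y = 1\<close> modulo some maximal ideal. Fix a maximal ideal \<open>M\<close> with
  residue field \<open>F\<close> and an element \<open>e\<close> that is \<open>1\<close> modulo \<open>M\<close> and lies in all other maximal ideals.
  Then \<open>(c, v) \<mapsto> v + c e\<close> identifies \<open>F \<times> M\<close> with \<open>R\<close>; the fibres over \<open>c\<close> and \<open>1/c\<close> are completely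
  joined, and vertices of different fibres are also joined through the other maximal ideals.
  The fibre over \<open>1\<close> is a clique, so a path with both ends in it that misses part of it extends to
  cycles of at least two consecutive lengths. It therefore suffices to find such paths whose number
  of vertices outside the clique hits every value up to an error of one.

  If \<open>M\<close> minus the Jacobson radical \<open>J\<close> is a singleton, then \<open>R\<close> is the product of the field with two
  elements and another field, and it has a vertex of degree one. So a Hamiltonian cycle forces
  \<open>M - J\<close> to have two elements, which is all that the construction needs. It depends on the choice
  of \<open>M\<close>: a residue field of even characteristic with more than two elements if there is one, otherwise
  one of odd characteristic, otherwise all residue fields have two elements.
\<close>

section \<open>Cycles as lists of vertices\<close>

text \<open>The tolerance of one is what makes parity harmless: completely joined fibres over
  \<open>c \<noteq> 1/c\<close> yield vertices two at a time. The obstacle is the fibre over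
  \<open>0\<close>, whose vertices have neighbours only through the other maximal ideals. They are
  reached by the matching of \<open>v\<close> with its generalised inverse. A pair
  \<open>c \<noteq> 1/c\<close> absorbs them one by one; a class \<open>c = 1/c\<close> other than
  \<open>1\<close>, that is \<open>c = -1\<close>, absorbs them by passages between two cliques,
  which come in twos. This explains the choice of \<open>M\<close>. In characteristic two,
  \<open>c = 1/c\<close> forces \<open>c = 1\<close>, so a pair exists as soon as there is a third
  residue class. In odd characteristic \<open>-1\<close> is always there, and trouble arises only if
  \<open>M - J\<close> has odd size. Negation pairs up \<open>M - J\<close> unless another residue
  field has characteristic two; that field has just two elements, since otherwise it would have been
  preferred, and the additional edges that it provides place the odd vertex. If all residue fields
  have two elements there is no third fibre, and the fibre over \<open>0\<close> has to be traversed
  by a path of its own.\<close>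

lemma cas_zip_rotate:
  "xs \<noteq> [] \<Longrightarrow> pre_digraph.cas (with_proj G) (hd xs) (zip xs (tl xs @ [v])) v"
proof (induction xs)
  case (Cons x xs)
  then show ?case by (cases xs) (auto simp: pre_digraph.cas.simps simp del: cas_with_proj_eq)
qed simp

text \<open>The arc list has a free end point \<open>v\<close>, since the equation
  \<open>v = hd xs\<close> would not survive the induction on \<open>xs\<close>.\<close>

lemma set_zip_rotate_subset:
  "xs \<noteq> [] \<Longrightarrow> successively E xs \<Longrightarrow> E (last xs) v \<Longrightarrow>
    set (zip xs (tl xs @ [v])) \<subseteq> {(x, y). E x y}"
proof (induction xs)
  case (Cons x xs)
  then show ?case by (cases xs) auto
qed simp

text \<open>The constructions work with vertex lists because paths can then simply be appended,
  whereas an arc list names every inner vertex twice.\<close>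

definition cycle_list :: "('a \<Rightarrow> 'a \<Rightarrow> bool) \<Rightarrow> 'a list \<Rightarrow> bool" where
  "cycle_list E xs \<longleftrightarrow> distinct xs \<and> 3 \<le> length xs \<and> successively E xs \<and> E (last xs) (hd xs)"

lemma graph_cycle_of_cycle_list:
  assumes "cycle_list (\<lambda>x y. (x, y) \<in> parcs G) xs" and "set xs \<subseteq> pverts G"
  shows "\<exists>p. graph_cycle G p \<and> length p = length xs"
proof -
  define p where "p = zip xs (tl xs @ [hd xs])"
  have ne: "xs \<noteq> []" using assms(1) by (auto simp: cycle_list_def)
  then have len: "length p = length xs" by (simp add: p_def)
  have snd: "map snd p = tl xs @ [hd xs]"
    using ne by (simp add: p_def)
  have cas: "pre_digraph.cas (with_proj G) (hd xs) p (hd xs)"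
    unfolding p_def by (rule cas_zip_rotate[OF ne])
  have "set p \<subseteq> parcs G"
    using set_zip_rotate_subset[of xs "\<lambda>x y. (x, y) \<in> parcs G" "hd xs"] ne assms(1)
    by (auto simp: p_def cycle_list_def)
  moreover have "hd xs \<in> pverts G" using ne assms(2) by auto
  ultimately have walk: "pre_digraph.awalk (with_proj G) (hd xs) p (hd xs)"
    using cas by (simp add: pre_digraph.awalk_def)
  have pne: "p \<noteq> []" using len ne by auto
  have "tl (pre_digraph.awalk_verts (with_proj G) (hd xs) p) = map snd p"
    using pre_digraph.awalk_verts_conv'[OF cas] pne by (simp add: comp_def)
  moreover have "distinct (tl xs @ [hd xs])"
    using assms(1) ne by (cases xs) (auto simp: cycle_list_def)
  ultimately have "pre_digraph.cycle (with_proj G) p"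
    unfolding pre_digraph.cycle_def using walk pne snd by auto
  then show ?thesis
    using len assms(1) by (auto simp: graph_cycle_def cycle_list_def)
qed

lemma graph_cycleD:
  assumes "graph_cycle G p"
  shows "set p \<subseteq> parcs G" "distinct (map fst p)" "distinct (map snd p)"
    "map fst p @ [fst (hd p)] = fst (hd p) # map snd p"
proof -
  obtain u where u: "pre_digraph.awalk (with_proj G) u p u"
    and d: "distinct (tl (pre_digraph.awalk_verts (with_proj G) u p))" and ne: "p \<noteq> []"
    using assms by (auto simp: graph_cycle_def pre_digraph.cycle_def)
  have cas: "pre_digraph.cas (with_proj G) u p u" and sub: "set p \<subseteq> parcs G"
    using u by (auto simp: pre_digraph.awalk_def)
  show "set p \<subseteq> parcs G" by (fact sub)
  have 1: "pre_digraph.awalk_verts (with_proj G) u p = fst (hd p) # map snd p"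
    using pre_digraph.awalk_verts_conv'[OF cas] ne by simp
  have 2: "pre_digraph.awalk_verts (with_proj G) u p = map fst p @ [snd (last p)]"
    using pre_digraph.awalk_verts_conv[of "with_proj G" u p] ne by simp
  have hd: "fst (hd p) = u" using cas ne pre_digraph.cas_simp[of p "with_proj G" u u] by simp
  have "last (map fst p @ [snd (last p)]) = u"
  proof -
    have "pre_digraph.cas (with_proj G) u p v \<Longrightarrow> p \<noteq> [] \<Longrightarrow> snd (last p) = v" for u v p
      by (induction p arbitrary: u) (auto simp: pre_digraph.cas.simps simp del: cas_with_proj_eq)
    then show ?thesis using cas ne by simp
  qed
  then have eq: "map fst p @ [fst (hd p)] = fst (hd p) # map snd p"
    using 1 2 hd by simp
  then show "map fst p @ [fst (hd p)] = fst (hd p) # map snd p" .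
  show ds: "distinct (map snd p)" using d 1 by simp
  \<comment> \<open>Sources and targets agree up to rotation, so the distinctness that
    \<open>cycle\<close> demands of the targets carries over to the sources.\<close>
  have "mset (map fst p) = mset (map snd p)"
    using arg_cong[OF eq, of mset] by simp
  then show "distinct (map fst p)"
    using ds mset_eq_imp_distinct_iff by blast
qed

lemma graph_cycle_two_neighbours:
  assumes "graph_cycle G p" "v \<in> fst ` set p"
  shows "\<exists>u w. u \<noteq> w \<and> (u, v) \<in> parcs G \<and> (v, w) \<in> parcs G"
proof -
  note D = graph_cycleD[OF assms(1)]
  define n where "n = length p"
  have n3: "3 \<le> n" using assms(1) by (simp add: graph_cycle_def n_def)
  have step: "fst (p ! (Suc i mod n)) = snd (p ! i)" if "i < n" for i
  proof -
    have "(map fst p @ [fst (hd p)]) ! Suc i = map snd p ! i" using D(4) by simp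
    moreover have "hd p = p ! 0" using n3 by (intro hd_conv_nth) (auto simp: n_def)
    ultimately show ?thesis
      using that n3 by (cases "Suc i = n") (auto simp: nth_append n_def)
  qed
  have inj: "i = j" if "fst (p ! i) = fst (p ! j)" "i < n" "j < n" for i j
    using D(2) that by (simp add: distinct_conv_nth n_def) metis
  obtain i where i: "i < n" "fst (p ! i) = v"
    using assms(2) by (auto simp: in_set_conv_nth n_def)
  \<comment> \<open>\<open>j\<close> is the cyclic predecessor of \<open>i\<close>; adding
    \<open>n\<close> avoids truncated subtraction at \<open>0\<close>. The successor is
    \<open>k\<close>.\<close>
  define j where "j = (i + n - 1) mod n"
  have j: "j < n" "Suc j mod n = i"
    using i n3 by (auto simp: j_def mod_Suc_eq)
  define k where "k = Suc i mod n"
  have k: "k < n" using n3 by (simp add: k_def)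
  \<comment> \<open>Otherwise \<open>i + 2\<close> and \<open>i\<close> agree modulo
    \<open>n\<close>, which \<open>3 \<le> n\<close> excludes.\<close>
  have kj: "k \<noteq> j"
  proof
    assume "k = j"
    then have "Suc (Suc i) mod n = i" using j by (metis k_def mod_Suc_eq)
    then show False using i n3 by (auto simp: mod_if split: if_splits)
  qed
  have "fst (p ! j) \<noteq> fst (p ! k)" using inj[OF _ j(1) k] kj by auto
  moreover have "fst (p ! k) = snd (p ! i)" using step[OF i(1)] by (simp add: k_def)
  moreover have "snd (p ! j) = v" using step[OF j(1)] i j by simp
  moreover have "p ! i \<in> parcs G" "p ! j \<in> parcs G"
    using D(1) i(1) j(1) by (auto simp: n_def)
  ultimately show ?thesis using i(2) by (metis prod.collapse)
qed

section \<open>Pancyclicity from paths attached to a clique\<close>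

definition pancyclic_on :: "('a \<Rightarrow> 'a \<Rightarrow> bool) \<Rightarrow> 'a set \<Rightarrow> bool" where
  "pancyclic_on E V \<longleftrightarrow>
    (\<forall>l. 3 \<le> l \<and> l \<le> card V \<longrightarrow> (\<exists>xs. cycle_list E xs \<and> set xs \<subseteq> V \<and> length xs = l))"

lemma clique_fill:
  assumes K: "finite K" "\<And>x y. x \<in> K \<Longrightarrow> y \<in> K \<Longrightarrow> x \<noteq> y \<Longrightarrow> E x y"
    and ys: "distinct ys" "successively E ys" "ys \<noteq> []" "hd ys \<in> K" "last ys \<in> K" "hd ys \<noteq> last ys"
    and l: "length ys \<le> l" "l \<le> card (set ys \<union> K)" "3 \<le> l"
  shows "\<exists>xs. cycle_list E xs \<and> set xs \<subseteq> set ys \<union> K \<and> length xs = l"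
proof -
  have "card (set ys \<union> K) = length ys + card (K - set ys)"
    using ys(1) K(1) by (simp add: card_Un_disjoint[symmetric] distinct_card[symmetric])
  then have "l - length ys \<le> card (K - set ys)" using l by simp
  then obtain T where T: "T \<subseteq> K - set ys" "card T = l - length ys" "finite T"
    using obtain_subset_with_card_n by blast
  obtain zs where zs: "set zs = T" "distinct zs" using finite_distinct_list[OF T(3)] by blast
  have "successively E zs"
    using K(2) zs T(1) by (subst successively_conv_nth) (auto simp: nth_eq_iff_index_eq, metis DiffD1 nth_mem Suc_lessD subsetD n_not_Suc_n nth_eq_iff_index_eq)
  moreover have "E (last ys) (hd zs)" if "zs \<noteq> []"
    using that zs T(1) ys(3,5) K(2)[of "last ys" "hd zs"] by (metis DiffD1 DiffD2 hd_in_set last_in_set subsetD)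
  ultimately have "successively E (ys @ zs)"
    using ys by (auto simp: successively_append_iff)
  moreover have "E (last (ys @ zs)) (hd (ys @ zs))"
  proof (cases "zs = []")
    case True then show ?thesis using ys K(2)[of "last ys" "hd ys"] by simp
  next
    case False
    then have "last zs \<in> K - set ys" using zs T(1) last_in_set[of zs] by blast
    then show ?thesis using False ys K(2)[of "last zs" "hd ys"] hd_in_set[of ys] by (simp, metis)
  qed
  moreover have "length (ys @ zs) = l"
    using zs T(2) l(1) distinct_card[of zs] by simp
  moreover have "distinct (ys @ zs)" using ys(1) zs T(1) by auto
  ultimately have "cycle_list E (ys @ zs)" using l(3) by (simp add: cycle_list_def)
  moreover have "set (ys @ zs) \<subseteq> set ys \<union> K" using zs T(1) by auto
  ultimately show ?thesis using \<open>length (ys @ zs) = l\<close> by blast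
qed

text \<open>The last conjunct keeps a clique vertex spare. An ear with \<open>s\<close> vertices
  outside \<open>K\<close> therefore closes up to length \<open>s + card K - 1\<close> as well as to
  \<open>s + card K\<close>.\<close>

definition ear :: "('a \<Rightarrow> 'a \<Rightarrow> bool) \<Rightarrow> 'a set \<Rightarrow> 'a set \<Rightarrow> 'a list \<Rightarrow> bool" where
  "ear E V K ys \<longleftrightarrow> distinct ys \<and> successively E ys \<and> set ys \<subseteq> V \<and> ys \<noteq> [] \<and> hd ys \<in> K \<and> last ys \<in> K
    \<and> hd ys \<noteq> last ys \<and> \<not> K \<subseteq> set ys"

lemma pancyclic_onI:
  assumes V: "finite V" "K \<subseteq> V" and K: "\<And>x y. x \<in> K \<Longrightarrow> y \<in> K \<Longrightarrow> x \<noteq> y \<Longrightarrow> E x y" "2 \<le> card K"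
    and good: "\<And>t. 1 \<le> t \<Longrightarrow> t \<le> card (V - K) \<Longrightarrow>
      \<exists>ys. ear E V K ys \<and> (card (set ys - K) = t \<or> card (set ys - K) = Suc t)"
  shows "pancyclic_on E V"
  unfolding pancyclic_on_def
proof (intro allI impI, elim conjE)
  fix l assume l: "3 \<le> l" "l \<le> card V"
  have fK: "finite K" using V finite_subset by blast
  show "\<exists>xs. cycle_list E xs \<and> set xs \<subseteq> V \<and> length xs = l"
  proof (cases "l \<le> card K")
    case True
    obtain a b where ab: "a \<in> K" "b \<in> K" "a \<noteq> b"
      using K(2) by (metis card_le_Suc0_iff_eq fK not_less_eq_eq numeral_2_eq_2)
    have "\<exists>xs. cycle_list E xs \<and> set xs \<subseteq> set [a, b] \<union> K \<and> length xs = l"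
      by (rule clique_fill) (use ab fK K True l in \<open>auto simp: insert_absorb\<close>)
    moreover have "set [a, b] \<union> K \<subseteq> V" using ab V(2) by auto
    ultimately show ?thesis by blast
  next
    case False
    \<comment> \<open>Length \<open>l\<close> is reached by \<open>t\<close> outer vertices and all
      of \<open>K\<close>, or by \<open>Suc t\<close> outer vertices and one clique vertex
      fewer.\<close>
    define t where "t = l - card K"
    have "1 \<le> t" "t \<le> card (V - K)" using l V fK False by (auto simp: t_def card_Diff_subset)
    from good[OF this] obtain ys
      where ys: "ear E V K ys" "card (set ys - K) = t \<or> card (set ys - K) = Suc t"
      by blast
    have c1: "length ys = card (set ys - K) + card (set ys \<inter> K)"
      using ys(1) by (metis List.finite_set add.commute card_Diff_subset_Int card_mono distinct_card ear_def finite_Int inf_le1 le_add_diff_inverse2)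
    have "set ys \<inter> K \<subset> K" using ys(1) by (auto simp: ear_def)
    then have "card (set ys \<inter> K) < card K" using fK psubset_card_mono by blast
    then have "length ys \<le> l" using c1 ys(2) False by (auto simp: t_def)
    moreover have "card (set ys \<union> K) = card (set ys - K) + card K"
      using fK by (metis List.finite_set Un_Diff_cancel2 card_Un_disjoint Diff_disjoint finite_Diff inf_commute)
    then have "l \<le> card (set ys \<union> K)" using ys(2) by (auto simp: t_def)
    ultimately have "\<exists>xs. cycle_list E xs \<and> set xs \<subseteq> set ys \<union> K \<and> length xs = l"
      using ys(1) fK K(1) l by (intro clique_fill) (auto simp: ear_def)
    moreover have "set ys \<union> K \<subseteq> V" using ys(1) V(2) by (auto simp: ear_def)
    ultimately show ?thesis by blast
  qed
qed

section \<open>Graphs on residue classes\<close>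

lemma distinct_list_hd:
  assumes "finite A" "x \<in> A" "1 \<le> i" "i \<le> card A"
  shows "\<exists>ls. distinct ls \<and> set ls \<subseteq> A \<and> length ls = i \<and> hd ls = x"
proof -
  have "i - 1 \<le> card (A - {x})" using assms by simp
  then obtain T where T: "T \<subseteq> A - {x}" "card T = i - 1" "finite T"
    using obtain_subset_with_card_n by blast
  obtain zs where "set zs = T" "distinct zs" using finite_distinct_list[OF T(3)] by blast
  then show ?thesis
    using T assms(2,3) distinct_card[of zs] by (intro exI[of _ "x # zs"]) auto
qed

lemma distinct_list_hd_last:
  assumes "finite A" "x \<in> A" "y \<in> A" "x \<noteq> y" "2 \<le> i" "i \<le> card A"
  shows "\<exists>ls. distinct ls \<and> set ls \<subseteq> A \<and> length ls = i \<and> hd ls = x \<and> last ls = y"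
proof -
  have "\<exists>ls. distinct ls \<and> set ls \<subseteq> A - {y} \<and> length ls = i - 1 \<and> hd ls = x"
    using assms by (intro distinct_list_hd) auto
  then obtain ls where "distinct ls" "set ls \<subseteq> A - {y}" "length ls = i - 1" "hd ls = x" by blast
  then show ?thesis
    using assms by (intro exI[of _ "ls @ [y]"]) (cases ls, auto)
qed

text \<open>
  In the application, \<open>C\<close> is the residue field \<open>F\<close> with inversion \<open>\<iota>\<close>, \<open>M\<close> the maximal ideal, \<open>J\<close> the
  Jacobson radical, and \<open>H v w\<close> says that \<open>v w = 1\<close> modulo a maximal ideal other than \<open>M\<close>.
\<close>

locale coords =
  fixes C :: "'c set" and zero one :: 'c and \<iota> :: "'c \<Rightarrow> 'c"
    and M J :: "'m set" and H :: "'m \<Rightarrow> 'm \<Rightarrow> bool" and bar :: "'m \<Rightarrow> 'm"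
  assumes fin: "finite C" "finite M"
    and zero: "zero \<in> C" and one: "one \<in> C" and zero_one: "zero \<noteq> one"
    and iota: "\<And>c. c \<in> C \<Longrightarrow> c \<noteq> zero \<Longrightarrow> \<iota> c \<in> C \<and> \<iota> c \<noteq> zero \<and> \<iota> (\<iota> c) = c"
    and iota_one: "\<iota> one = one"
    and J: "J \<subseteq> M" "J \<noteq> {}"
    and H_sym: "\<And>v w. H v w \<Longrightarrow> H w v"
    and bar: "\<And>v. v \<in> M - J \<Longrightarrow> bar v \<in> M - J \<and> bar (bar v) = v \<and> H v (bar v)"
    and two: "2 \<le> card (M - J)"
begin

text \<open>The disjuncts are adjacency modulo \<open>M\<close> and modulo another maximal ideal.
  The guard on \<open>fst p\<close> is there because \<open>\<iota> zero\<close> is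
  unconstrained.\<close>

definition adj :: "'c \<times> 'm \<Rightarrow> 'c \<times> 'm \<Rightarrow> bool" where
  "adj p q \<longleftrightarrow> p \<noteq> q \<and> (fst p \<noteq> zero \<and> fst q = \<iota> (fst p) \<or> H (snd p) (snd q))"

text \<open>The part taken away, \<open>{zero} \<times> J\<close>, holds the coordinates of the
  Jacobson radical.\<close>

definition V :: "('c \<times> 'm) set" where
  "V = C \<times> M - {zero} \<times> J"

definition K :: "('c \<times> 'm) set" where
  "K = {one} \<times> M"

text \<open>In contrast to a group of units this leaves out \<open>one\<close>, whose fibre is the
  clique \<open>K\<close>.\<close>

definition units :: "'c set" where
  "units = C - {zero, one}"

lemma units: "c \<in> units \<Longrightarrow> c \<in> C \<and> c \<noteq> zero \<and> c \<noteq> one \<and> \<iota> c \<in> units \<and> \<iota> (\<iota> c) = c"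
  using iota iota_one by (auto simp: units_def)

lemma H_bar: "v \<in> M - J \<Longrightarrow> H v (bar v)" "v \<in> M - J \<Longrightarrow> H (bar v) v"
  using bar H_sym by blast+

lemma bar_inj: "inj_on bar (M - J)"
  by (metis bar inj_onI)

lemma bar_eq: "v \<in> M - J \<Longrightarrow> w \<in> M - J \<Longrightarrow> bar v = bar w \<longleftrightarrow> v = w"
  using bar_inj by (auto simp: inj_on_def)

lemma card_M: "card M = card (M - J) + card J" "1 \<le> card J" "3 \<le> card M"
proof -
  have "finite J" using J fin finite_subset by blast
  then show "card M = card (M - J) + card J" "1 \<le> card J"
    using J by (auto simp: card_Diff_subset card_mono fin Suc_le_eq card_gt_0_iff)
  then show "3 \<le> card M" using two by simp
qed

lemma V_minus_K: "V - K = {zero} \<times> (M - J) \<union> units \<times> M"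
  using zero zero_one one by (auto simp: V_def K_def units_def)

lemma card_V_minus_K: "card (V - K) = card (M - J) + card units * card M"
  using fin unfolding V_minus_K
  by (subst card_Un_disjoint) (auto simp: card_cartesian_product units_def)

lemma pancyclic_on_V:
  assumes "\<And>t. 1 \<le> t \<Longrightarrow> t \<le> card (M - J) + card units * card M \<Longrightarrow>
      \<exists>ys. ear adj V K ys \<and> (card (set ys - K) = t \<or> card (set ys - K) = Suc t)"
  shows "pancyclic_on adj V"
proof (rule pancyclic_onI)
  show "finite V" using fin by (auto simp: V_def)
  show "K \<subseteq> V" using one zero_one by (auto simp: K_def V_def)
  show "adj x y" if "x \<in> K" "y \<in> K" "x \<noteq> y" for x y
    using that zero_one iota_one by (auto simp: adj_def K_def)
  show "2 \<le> card K" using card_M by (simp add: K_def card_cartesian_product)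
  show "\<exists>ys. ear adj V K ys \<and> (card (set ys - K) = t \<or> card (set ys - K) = Suc t)"
    if "1 \<le> t" "t \<le> card (V - K)" for t
    using that assms card_V_minus_K by simp
qed

section \<open>Paths over fibres of mutually inverse residue classes\<close>

lemma pairs_segment:
  assumes b: "b \<in> units" "\<iota> b \<noteq> b" and st: "s \<in> M" "t \<in> M" and i: "1 \<le> i" "i \<le> card M"
  shows "\<exists>xs. distinct xs \<and> successively adj xs \<and> set xs \<subseteq> {b, \<iota> b} \<times> M \<and> length xs = 2 * i
    \<and> hd xs = (b, s) \<and> last xs = (\<iota> b, t)"
proof -
  \<comment> \<open>The two fibres are completely joined, so any two lists of equal length can be
    interleaved.\<close>
  have *: "length ls = length rs \<Longrightarrow> distinct ls \<Longrightarrow> distinct rs \<Longrightarrow>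
    \<exists>xs. distinct xs \<and> successively adj xs \<and> set xs = {b} \<times> set ls \<union> {\<iota> b} \<times> set rs
      \<and> length xs = 2 * length ls
      \<and> (ls \<noteq> [] \<longrightarrow> hd xs = (b, hd ls) \<and> last xs = (\<iota> b, last rs))" for ls rs :: "'m list"
  proof (induction ls rs rule: list_induct2)
    case (Cons x ls y rs)
    have "distinct ls" "distinct rs" using Cons.prems by auto
    from Cons.IH[OF this] obtain xs where xs: "distinct xs" "successively adj xs"
      "set xs = {b} \<times> set ls \<union> {\<iota> b} \<times> set rs" "length xs = 2 * length ls"
      "ls \<noteq> [] \<longrightarrow> hd xs = (b, hd ls) \<and> last xs = (\<iota> b, last rs)" by blast
    have e: "xs = [] \<longleftrightarrow> ls = []" "rs = [] \<longleftrightarrow> ls = []" using xs(4) Cons.hyps by auto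
    let ?xs = "(b, x) # (\<iota> b, y) # xs"
    have b': "b \<noteq> zero" "\<iota> b \<noteq> zero" "\<iota> (\<iota> b) = b" using b units iota by blast+
    have "distinct ?xs" using b(2) xs(1,3) Cons.prems by simp
    moreover have "adj (b, x) (\<iota> b, y)" "adj (\<iota> b, y) (b, hd ls)"
      using b' b(2) by (simp_all add: adj_def)
    then have "successively adj ?xs"
      using xs(2,5) e(1) by (cases "ls = []") (auto simp: successively_Cons)
    moreover have "set ?xs = {b} \<times> set (x # ls) \<union> {\<iota> b} \<times> set (y # rs)"
      using xs(3) by auto
    moreover have "length ?xs = 2 * length (x # ls)" using xs(4) by simp
    moreover have "last ?xs = (\<iota> b, last (y # rs))" using xs(5) e by auto
    ultimately show ?case by (intro exI[of _ ?xs]) simp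
  qed simp
  obtain ls where ls: "distinct ls" "set ls \<subseteq> M" "length ls = i" "hd ls = s"
    using distinct_list_hd[OF fin(2) st(1) i] by blast
  obtain rs where rs: "distinct rs" "set rs \<subseteq> M" "length rs = i" "hd rs = t"
    using distinct_list_hd[OF fin(2) st(2) i] by blast
  have "ls \<noteq> []" "rs \<noteq> []" using ls rs i by auto
  \<comment> \<open>Reversed, \<open>rs\<close> ends in \<open>t\<close>, and so does the
    interleaved path.\<close>
  moreover have "length ls = length (rev rs)" "distinct (rev rs)" using ls rs by auto
  ultimately obtain xs where "distinct xs" "successively adj xs"
    "set xs = {b} \<times> set ls \<union> {\<iota> b} \<times> set (rev rs)" "length xs = 2 * length ls"
    "hd xs = (b, hd ls)" "last xs = (\<iota> b, last (rev rs))"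
    using *[of ls "rev rs"] ls(1) by blast
  moreover have "set xs \<subseteq> {b, \<iota> b} \<times> M"
    using calculation(3) ls(2) rs(2) by auto
  ultimately show ?thesis
    using ls(3,4) rs(4) \<open>rs \<noteq> []\<close> by (intro exI[of _ xs]) (simp add: last_rev)
qed

text \<open>Blocks over the pairs \<open>{b, \<iota> b}\<close> are concatenated. Every block starts
  at second coordinate \<open>s\<close> and ends at \<open>t\<close>, so the single relation
  \<open>H t s\<close> links them all. Evenness of \<open>card Z\<close> is proved along with the
  paths because the part of \<open>n\<close> left for the last block has to be even.\<close>

lemma segment:
  assumes "finite Z" "Z \<subseteq> units" "\<And>c. c \<in> Z \<Longrightarrow> \<iota> c \<in> Z \<and> \<iota> c \<noteq> c"
    and st: "s \<in> M" "t \<in> M" "H t s"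
  shows "even (card Z) \<and> (\<forall>n. even n \<and> n \<le> card Z * card M \<longrightarrow>
    (\<exists>xs. distinct xs \<and> successively adj xs \<and> set xs \<subseteq> Z \<times> M \<and> length xs = n
      \<and> (xs \<noteq> [] \<longrightarrow> snd (hd xs) = s \<and> snd (last xs) = t)))"
  using assms(1-3)
proof (induction "card Z" arbitrary: Z rule: less_induct)
  case less
  show ?case
  proof (cases "Z = {}")
    case False
    then obtain b where b: "b \<in> Z" by blast
    then have bu: "b \<in> units" "\<iota> b \<noteq> b" "\<iota> b \<in> Z" using less.prems by auto
    define Y where "Y = Z - {b, \<iota> b}"
    have sub: "{b, \<iota> b} \<subseteq> Z" using b bu by simp
    have cZ: "card Z = card Y + 2"
    proof -
      have "card {b, \<iota> b} = 2" using bu(2) by simp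
      moreover have "card {b, \<iota> b} \<le> card Z" using sub less.prems(1) by (rule card_mono[rotated])
      ultimately show ?thesis unfolding Y_def using sub by (subst card_Diff_subset) auto
    qed
    have Y: "\<iota> c \<in> Y \<and> \<iota> c \<noteq> c" if "c \<in> Y" for c
      using that less.prems(2) less.prems(3)[of c] units[of c] units[of b] bu(1) by (auto simp: Y_def)
    have IH: "even (card Y) \<and> (\<forall>n. even n \<and> n \<le> card Y * card M \<longrightarrow>
      (\<exists>xs. distinct xs \<and> successively adj xs \<and> set xs \<subseteq> Y \<times> M \<and> length xs = n
        \<and> (xs \<noteq> [] \<longrightarrow> snd (hd xs) = s \<and> snd (last xs) = t)))"
      by (rule less.hyps) (use less.prems cZ Y in \<open>auto simp: Y_def\<close>)
    have "\<exists>xs. distinct xs \<and> successively adj xs \<and> set xs \<subseteq> Z \<times> M \<and> length xs = n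
        \<and> (xs \<noteq> [] \<longrightarrow> snd (hd xs) = s \<and> snd (last xs) = t)"
      if n: "even n" "n \<le> card Z * card M" for n
    proof (cases "n \<le> card Y * card M")
      case True
      then obtain xs where "distinct xs \<and> successively adj xs \<and> set xs \<subseteq> Y \<times> M \<and> length xs = n
        \<and> (xs \<noteq> [] \<longrightarrow> snd (hd xs) = s \<and> snd (last xs) = t)" using IH n(1) by blast
      then show ?thesis by (intro exI[of _ xs]) (auto simp: Y_def)
    next
      case False
      obtain xs where xs: "distinct xs" "successively adj xs" "set xs \<subseteq> Y \<times> M"
        "length xs = card Y * card M" "xs \<noteq> [] \<longrightarrow> snd (hd xs) = s \<and> snd (last xs) = t"
        using IH by (metis dvd_mult2 order_refl)
      \<comment> \<open>The pairs in \<open>Y\<close> are used up completely, and the new pair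
        supplies the remaining \<open>2 * i\<close> vertices.\<close>
      define i where "i = (n - card Y * card M) div 2"
      have "even (n - card Y * card M)" using n IH by simp
      then have i2: "n = card Y * card M + 2 * i" using False by (simp add: i_def)
      then have "1 \<le> i" "i \<le> card M" using n(2) False cZ by (auto simp: algebra_simps)
      from pairs_segment[OF bu(1,2) st(1,2) this]
      obtain ys where ys: "distinct ys" "successively adj ys" "set ys \<subseteq> {b, \<iota> b} \<times> M"
        "length ys = 2 * i" "hd ys = (b, s)" "last ys = (\<iota> b, t)" by blast
      have "ys \<noteq> []" using ys(4) \<open>1 \<le> i\<close> by auto
      moreover have "adj (last xs) (hd ys)" if "xs \<noteq> []"
      proof -
        have "last xs \<in> Y \<times> M" using xs(3) that by auto
        then show ?thesis using xs(5) that ys(5) st(3) by (auto simp: adj_def Y_def)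
      qed
      ultimately have "successively adj (xs @ ys)"
        using xs(2) ys(2) by (auto simp: successively_append_iff)
      moreover have "set xs \<inter> set ys = {}" using xs(3) ys(3) by (auto simp: Y_def)
      moreover have "set (xs @ ys) \<subseteq> Z \<times> M" using xs(3) ys(3) sub by (auto simp: Y_def)
      ultimately show ?thesis
        using xs(1,4,5) ys(1,4,5,6) i2 \<open>ys \<noteq> []\<close> by (intro exI[of _ "xs @ ys"]) (auto simp: hd_append)
    qed
    then show ?thesis using IH cZ by simp
  next
    case True
    then show ?thesis by (auto intro!: exI[of _ "[]"])
  qed
qed

lemma two_elements:
  obtains w q where "w \<in> M - J" "q \<in> M - J" "w \<noteq> q"
proof -
  have "\<not> card (M - J) \<le> Suc 0" using two by simp
  then show ?thesis using that card_le_Suc0_iff_eq[of "M - J"] fin by auto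
qed

text \<open>\<open>D\<close> selects the values \<open>v\<close> at which the path makes the detour
  through \<open>(zero, bar v)\<close>. Consecutive entries of \<open>vs\<close> need not be
  related, as the fibres over \<open>a\<close> and \<open>\<iota> a\<close> are completely
  joined.\<close>

lemma matched_segment:
  assumes a: "a \<in> units" "\<iota> a \<noteq> a" and D: "D \<subseteq> M - J"
    and vs: "distinct vs" "set vs \<subseteq> M"
  shows "\<exists>xs. distinct xs \<and> successively adj xs
    \<and> set xs = {a, \<iota> a} \<times> set vs \<union> {zero} \<times> bar ` (D \<inter> set vs)
    \<and> (xs = [] \<longleftrightarrow> vs = []) \<and> (vs \<noteq> [] \<longrightarrow> hd xs = (a, hd vs) \<and> last xs = (\<iota> a, last vs))"
  using vs
proof (induction vs)
  case (Cons v vs)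
  have "distinct vs" "set vs \<subseteq> M" using Cons.prems by auto
  from Cons.IH[OF this] obtain xs where xs: "distinct xs" "successively adj xs"
    "set xs = {a, \<iota> a} \<times> set vs \<union> {zero} \<times> bar ` (D \<inter> set vs)" "xs = [] \<longleftrightarrow> vs = []"
    "vs \<noteq> [] \<longrightarrow> hd xs = (a, hd vs) \<and> last xs = (\<iota> a, last vs)" by blast
  have a': "a \<noteq> zero" "\<iota> a \<noteq> zero" "\<iota> (\<iota> a) = a" using a units iota by blast+
  have lnk: "adj (\<iota> a, v) (hd xs)" if "xs \<noteq> []"
    using that xs(4,5) a' a(2) by (auto simp: adj_def)
  show ?case
  proof (cases "v \<in> D")
    case True
    let ?xs = "(a, v) # (zero, bar v) # (\<iota> a, v) # xs"
    have vJ: "v \<in> M - J" using True D by blast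
    have "bar v \<notin> bar ` (D \<inter> set vs)"
      using bar_eq[OF vJ] D Cons.prems(1) by auto
    then have "distinct ?xs" using xs(1,3) Cons.prems(1) a' a(2) by auto
    moreover have "adj (a, v) (zero, bar v)" "adj (zero, bar v) (\<iota> a, v)"
      using a' H_bar[OF vJ] by (simp_all add: adj_def)
    then have "successively adj ?xs" using xs(2) lnk by (auto simp: successively_Cons)
    moreover have "set ?xs = {a, \<iota> a} \<times> set (v # vs) \<union> {zero} \<times> bar ` (D \<inter> set (v # vs))"
      using xs(3) True by auto
    moreover have "last ?xs = (\<iota> a, last (v # vs))" using xs(4,5) by auto
    ultimately show ?thesis by (intro exI[of _ ?xs]) simp
  next
    case False
    let ?xs = "(a, v) # (\<iota> a, v) # xs"
    have "distinct ?xs" using xs(1,3) Cons.prems(1) a' a(2) by auto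
    moreover have "adj (a, v) (\<iota> a, v)"
      using a' a(2) by (simp add: adj_def)
    then have "successively adj ?xs" using xs(2) lnk by (auto simp: successively_Cons)
    moreover have "set ?xs = {a, \<iota> a} \<times> set (v # vs) \<union> {zero} \<times> bar ` (D \<inter> set (v # vs))"
      using xs(3) False by auto
    moreover have "last ?xs = (\<iota> a, last (v # vs))" using xs(4,5) by auto
    ultimately show ?thesis by (intro exI[of _ ?xs]) simp
  qed
qed simp

text \<open>
  Over a pair \<open>a \<noteq> \<iota> a\<close>, every \<open>(zero, bar v)\<close> fits between \<open>(a, v)\<close> and \<open>(\<iota> a, v)\<close>, so one such pair
  absorbs the whole fibre over \<open>zero\<close>. Leaving it at \<open>bar q\<close> with \<open>q \<noteq> w\<close> makes the two ends
  \<open>(one, w)\<close> and \<open>(one, q)\<close> of the ear distinct.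
\<close>

lemma pancyclic_no_involution:
  assumes ne: "units \<noteq> {}" and free: "\<And>c. c \<in> units \<Longrightarrow> \<iota> c \<noteq> c"
  shows "pancyclic_on adj V"
proof (rule pancyclic_on_V)
  fix t assume t: "1 \<le> t" "t \<le> card (M - J) + card units * card M"
  obtain w q where wq: "w \<in> M - J" "q \<in> M - J" "w \<noteq> q" by (rule two_elements)
  then have wq_in: "w \<in> M" "q \<in> M" "bar w \<in> M" "bar q \<in> M" "bar w \<noteq> bar q"
    using bar[OF wq(1)] bar[OF wq(2)] bar_eq[OF wq(1,2)] by auto
  obtain a where a: "a \<in> units" using ne by blast
  have aa: "\<iota> a \<noteq> a" "\<iota> a \<in> units" "a \<noteq> zero" "\<iota> a \<noteq> zero" "a \<noteq> one" "\<iota> a \<noteq> one" "\<iota> (\<iota> a) = a"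
    using units[OF a] units[of "\<iota> a"] free[OF a] by auto
  define Z where "Z = units - {a, \<iota> a}"
  have fu: "finite units" using fin by (simp add: units_def)
  have cU: "card units = card Z + 2"
  proof -
    have "card {a, \<iota> a} = 2" using aa by simp
    moreover have "{a, \<iota> a} \<subseteq> units" using a aa by simp
    moreover have "card {a, \<iota> a} \<le> card units" using fu \<open>{a, \<iota> a} \<subseteq> units\<close> by (rule card_mono)
    ultimately show ?thesis unfolding Z_def by (subst card_Diff_subset) auto
  qed
  have Zi: "\<iota> c \<in> Z \<and> \<iota> c \<noteq> c" if "c \<in> Z" for c
    using that units[of c] free[of c] aa units[of a] by (auto simp: Z_def)
  have seg: "even (card Z) \<and> (\<forall>n. even n \<and> n \<le> card Z * card M \<longrightarrow>
    (\<exists>xs. distinct xs \<and> successively adj xs \<and> set xs \<subseteq> Z \<times> M \<and> length xs = n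
      \<and> (xs \<noteq> [] \<longrightarrow> snd (hd xs) = bar w \<and> snd (last xs) = w)))"
    by (rule segment) (use fu Zi wq_in H_bar[OF wq(1)] in \<open>auto simp: Z_def\<close>)
  \<comment> \<open>The ear consists of \<open>(one, w)\<close>, then \<open>n\<close> vertices over
    \<open>Z\<close>, then \<open>xs\<close>, then \<open>(one, q)\<close>. Since the part over
    \<open>Z\<close> runs from \<open>bar w\<close> to \<open>w\<close>, the relation between
    \<open>w\<close> and \<open>bar w\<close> serves at both of its ends, and also joins
    \<open>(one, w)\<close> to \<open>xs\<close> if that part is empty.\<close>
  have build: "\<exists>ys. ear adj V K ys \<and> card (set ys - K) = n + 2 * length vs + card D"
    if n: "even n" "n \<le> card Z * card M"
      and vs: "hd vs = bar w" "last xs = (\<iota> a, bar q)" "set vs \<subseteq> M" "xs \<noteq> []" "hd xs = (a, bar w)"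
        "distinct xs" "successively adj xs" "distinct vs"
        "set xs \<subseteq> {a, \<iota> a} \<times> M \<union> {zero} \<times> bar ` D"
        "card (set xs) = 2 * length vs + card D"
      and D: "D \<subseteq> M - J" for n vs xs D
  proof -
    obtain zs where zs: "distinct zs" "successively adj zs" "set zs \<subseteq> Z \<times> M" "length zs = n"
      "zs \<noteq> [] \<longrightarrow> snd (hd zs) = bar w \<and> snd (last zs) = w" using seg n by blast
    let ?ys = "(one, w) # zs @ xs @ [(one, q)]"
    have bD: "bar ` D \<subseteq> M - J" using D bar by blast
    have Zz: "set zs \<subseteq> V" "set zs \<inter> K = {}" "set zs \<inter> set xs = {}" "set xs \<subseteq> V" "set xs \<inter> K = {}"
    proof -
      have x: "set xs \<subseteq> {a, \<iota> a} \<times> M \<union> {zero} \<times> (M - J)" using vs(9) bD by blast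
      have "a \<in> C" "\<iota> a \<in> C" using a aa(2) units by blast+
      then have "{a, \<iota> a} \<times> M \<union> {zero} \<times> (M - J) \<subseteq> V - K"
        using aa zero zero_one by (auto simp: V_def K_def)
      then show "set xs \<subseteq> V" "set xs \<inter> K = {}" using x by blast+
      have "Z \<times> M \<subseteq> V - K" using units by (auto simp: V_def K_def Z_def)
      then show "set zs \<subseteq> V" "set zs \<inter> K = {}" using zs(3) by blast+
      have "Z \<times> M \<inter> ({a, \<iota> a} \<times> M \<union> {zero} \<times> (M - J)) = {}"
        using units by (auto simp: Z_def)
      then show "set zs \<inter> set xs = {}" using zs(3) x by blast
    qed
    have onewq: "(one, w) \<in> K" "(one, q) \<in> K" "(one, w) \<in> V" "(one, q) \<in> V"
      using wq one zero_one by (auto simp: V_def K_def)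
    have "distinct ?ys" using zs(1) vs(6) Zz onewq wq(3) by auto
    moreover have "successively adj ?ys"
    proof -
      have l1: "adj (one, w) (hd zs)" if "zs \<noteq> []"
        using that zs(5) H_bar[OF wq(1)] Zz(2) onewq(1) hd_in_set[OF that]
        by (cases "hd zs") (auto simp: adj_def)
      have l2: "adj (last zs) (a, bar w)" if "zs \<noteq> []"
        using that zs(5) H_bar[OF wq(1)] zs(3) last_in_set[OF that]
        by (cases "last zs") (auto simp: adj_def Z_def)
      have l3: "adj (\<iota> a, bar q) (one, q)" "adj (one, w) (a, bar w)"
        using H_bar wq aa by (auto simp: adj_def)
      show ?thesis
        using l1 l2 l3 zs(2) vs(2,4,5,7)
        by (cases "zs = []") (auto simp: successively_append_iff successively_Cons)
    qed
    moreover have "set ?ys \<subseteq> V" using Zz onewq by simp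
    moreover have "\<not> K \<subseteq> set ?ys"
    proof -
      obtain j where j: "j \<in> J" using J by blast
      then have "(one, j) \<in> K" using J by (auto simp: K_def)
      moreover have "(one, j) \<notin> set ?ys" using j wq Zz(2,5) calculation by auto
      ultimately show ?thesis by blast
    qed
    ultimately have "ear adj V K ?ys" using onewq wq(3) by (simp add: ear_def)
    moreover have "set ?ys - K = set zs \<union> set xs" using Zz onewq by auto
    then have "card (set ?ys - K) = n + 2 * length vs + card D"
      using Zz(3) vs(10) zs(1,4) by (simp add: card_Un_disjoint distinct_card)
    ultimately show ?thesis by blast
  qed
  show "\<exists>ys. ear adj V K ys \<and> (card (set ys - K) = t \<or> card (set ys - K) = Suc t)"
  proof (cases "t \<le> card Z * card M + 2")
    case True
    \<comment> \<open>The shortest choice of \<open>xs\<close> has the two vertices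
      \<open>(a, bar w)\<close> and \<open>(\<iota> a, bar q)\<close>. \<open>n\<close> is
      \<open>t - 2\<close> rounded up to an even number, which respects the bound
      \<open>card Z * card M\<close> because that bound is even.\<close>
    define n where "n = (if even t then t - 2 else t - 1)"
    have ev: "even (card Z * card M)" using seg by simp
    have n: "even n" "n \<le> card Z * card M" "n + 2 = t \<or> n + 2 = Suc t"
    proof -
      define p where "p = card Z * card M"
      have p: "even p" "t \<le> p + 2" using ev True by (simp_all add: p_def)
      then show "n \<le> card Z * card M" unfolding p_def[symmetric] n_def by presburger
      show "even n" "n + 2 = t \<or> n + 2 = Suc t" using t(1) unfolding n_def by presburger+
    qed
    have "\<exists>ys. ear adj V K ys \<and> card (set ys - K) = n + 2 * length [bar w] + card ({} :: 'm set)"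
      by (rule build[OF n(1,2), where xs = "[(a, bar w), (\<iota> a, bar q)]"])
        (use wq_in aa in \<open>auto simp: adj_def\<close>)
    then show ?thesis using n(3) by auto
  next
    case False
    define r where "r = t - card Z * card M"
    have r: "3 \<le> r" "r \<le> card (M - J) + 2 * card M"
      using False t(2) cU by (auto simp: r_def algebra_simps)
    \<comment> \<open>\<open>i\<close> entries of \<open>vs\<close> contribute two vertices each,
      and \<open>d\<close> detours one each. Detours are made only when \<open>vs\<close> exhausts
      \<open>M\<close>, so that every \<open>D\<close> is available; \<open>2 \<le> i\<close> leaves
      room for the distinct ends \<open>bar w\<close> and \<open>bar q\<close>.\<close>
    have "\<exists>i d. 2 \<le> i \<and> i \<le> card M \<and> d \<le> card (M - J) \<and> (d = 0 \<or> i = card M)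
      \<and> (2 * i + d = r \<or> 2 * i + d = Suc r)"
    proof (cases "r \<le> 2 * card M")
      case True
      have h: "2 \<le> (r + 1) div 2" "(r + 1) div 2 \<le> card M"
        "2 * ((r + 1) div 2) = r \<or> 2 * ((r + 1) div 2) = Suc r"
        using r(1) True by presburger+
      show ?thesis by (rule exI[of _ "(r + 1) div 2"], rule exI[of _ 0]) (use h in simp)
    next
      case False
      show ?thesis
        by (rule exI[of _ "card M"], rule exI[of _ "r - 2 * card M"]) (use False r card_M in auto)
    qed
    then obtain i d where id: "2 \<le> i" "i \<le> card M" "d \<le> card (M - J)" "d = 0 \<or> i = card M"
      "2 * i + d = r \<or> 2 * i + d = Suc r" by blast
    obtain vs where vs: "distinct vs" "set vs \<subseteq> M" "length vs = i" "hd vs = bar w" "last vs = bar q"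
      using distinct_list_hd_last[OF fin(2) wq_in(3,4,5) id(1,2)] by blast
    obtain D where D: "D \<subseteq> M - J" "card D = d" using obtain_subset_with_card_n[OF id(3)] by blast
    have Dvs: "D \<subseteq> set vs"
    proof (cases "d = 0")
      case True
      then show ?thesis using D fin finite_subset[OF D(1)] by auto
    next
      case False
      then have "set vs = M" using id(4) vs distinct_card[OF vs(1)] fin(2) by (metis card_subset_eq)
      then show ?thesis using D by auto
    qed
    have "vs \<noteq> []" using vs(3) id(1) by auto
    obtain xs where xs0: "distinct xs \<and> successively adj xs
      \<and> set xs = {a, \<iota> a} \<times> set vs \<union> {zero} \<times> bar ` (D \<inter> set vs)
      \<and> (xs = [] \<longleftrightarrow> vs = []) \<and> (vs \<noteq> [] \<longrightarrow> hd xs = (a, hd vs) \<and> last xs = (\<iota> a, last vs))"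
      using matched_segment[OF a aa(1) D(1) vs(1,2)] by (rule exE)
    then have xs: "distinct xs" "successively adj xs"
      "set xs = {a, \<iota> a} \<times> set vs \<union> {zero} \<times> bar ` (D \<inter> set vs)" "xs \<noteq> []"
      "hd xs = (a, bar w)" "last xs = (\<iota> a, bar q)" using vs(4,5) \<open>vs \<noteq> []\<close> by simp_all
    have "D \<inter> set vs = D" using Dvs by auto
    then have sx: "set xs = {a, \<iota> a} \<times> set vs \<union> {zero} \<times> bar ` D" using xs(3) by simp
    have fD: "finite D" using D(1) fin finite_subset by blast
    have "card (bar ` D) = d" using D bar_inj by (metis card_image inj_on_subset)
    moreover have "card ({a, \<iota> a} \<times> set vs) = 2 * i"
      using aa vs(1,3) by (simp add: card_cartesian_product distinct_card)
    ultimately have cx: "card (set xs) = 2 * length vs + card D"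
      unfolding sx using aa fD D(2) vs(3)
      by (subst card_Un_disjoint) (auto simp: card_cartesian_product)
    have "\<exists>ys. ear adj V K ys \<and> card (set ys - K) = card Z * card M + 2 * length vs + card D"
    proof (rule build[OF _ le_refl vs(4) xs(6) vs(2) xs(4,5,1,2) vs(1) _ cx D(1)])
      show "even (card Z * card M)" using seg by simp
      show "set xs \<subseteq> {a, \<iota> a} \<times> M \<union> {zero} \<times> bar ` D"
        unfolding sx using vs(2) by blast
    qed
    then obtain ys where ys: "ear adj V K ys"
      "card (set ys - K) = card Z * card M + 2 * length vs + card D" by blast
    have "card (set ys - K) = t \<or> card (set ys - K) = Suc t"
      unfolding ys(2) vs(3) D(2) using id(5) False unfolding r_def by linarith
    then show ?thesis using ys(1) by blast
  qed
qed

text \<open>Here all vertices outside the clique lie over \<open>zero\<close>, where only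
  \<open>H\<close> provides edges. Initial parts of the path \<open>vs\<close> serve as ears:
  \<open>H v v\<close> joins \<open>(one, v)\<close> to \<open>(zero, v)\<close> at either
  end.\<close>

lemma pancyclic_trivial:
  assumes none: "units = {}" and refl: "\<And>v. v \<in> M - J \<Longrightarrow> H v v"
    and vs: "distinct vs" "set vs = M - J" "successively H vs"
  shows "pancyclic_on adj V"
proof (rule pancyclic_on_V)
  fix t assume t: "1 \<le> t" "t \<le> card (M - J) + card units * card M"
  \<comment> \<open>At least two vertices are taken so that the ear has distinct ends; for
    \<open>t = 1\<close> this is the permitted \<open>Suc t\<close>.\<close>
  define k where "k = max 2 t"
  define ws where "ws = take k vs"
  have lv: "length vs = card (M - J)" using vs distinct_card by metis
  have lw: "length ws = k" "2 \<le> k" "k = t \<or> k = Suc t"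
    using lv t none two by (auto simp: k_def ws_def)
  have ws: "distinct ws" "set ws \<subseteq> M - J" "successively H ws" "ws \<noteq> []"
  proof -
    show "distinct ws" using vs by (simp add: ws_def)
    show "set ws \<subseteq> M - J" using vs(2) set_take_subset by (fastforce simp: ws_def)
    show "successively H ws"
      using vs(3) by (metis append_take_drop_id successively_append_iff ws_def)
    show "ws \<noteq> []" using lw by auto
  qed
  have hl: "hd ws \<noteq> last ws"
    using lw ws by (cases ws) (auto split: if_splits)
  have m: "hd ws \<in> M - J" "last ws \<in> M - J" using ws(2,4) hd_in_set last_in_set by blast+
  let ?ys = "(one, hd ws) # map (Pair zero) ws @ [(one, last ws)]"
  have "successively adj (map (Pair zero) ws)"
    unfolding successively_map
    using ws(1,3) by (auto simp: successively_conv_nth adj_def nth_eq_iff_index_eq)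
  moreover have "adj (one, hd ws) (zero, hd ws)" "adj (zero, last ws) (one, last ws)"
    using refl m zero_one by (auto simp: adj_def)
  ultimately have "successively adj ?ys"
    using ws(4) by (auto simp: successively_append_iff successively_Cons hd_map last_map)
  moreover have "distinct ?ys"
    using ws(1) zero_one hl by (auto simp: distinct_map inj_on_def)
  moreover have "set ?ys \<subseteq> V" using ws(2) m one zero zero_one by (auto simp: V_def)
  moreover have "\<not> K \<subseteq> set ?ys"
  proof -
    obtain j where "j \<in> J" using J by blast
    then have "(one, j) \<in> K" "(one, j) \<notin> set ?ys" using J m zero_one by (auto simp: K_def)
    then show ?thesis by blast
  qed
  ultimately have "ear adj V K ?ys" using m hl by (auto simp: ear_def K_def)
  moreover have "set ?ys - K = {zero} \<times> set ws" using m zero_one by (auto simp: K_def)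
  then have "card (set ?ys - K) = k"
    using ws(1) lw by (simp add: card_cartesian_product distinct_card)
  ultimately show "\<exists>ys. ear adj V K ys \<and> (card (set ys - K) = t \<or> card (set ys - K) = Suc t)"
    using lw(3) by blast
qed

text \<open>
  If \<open>\<iota> m = m\<close>, the fibre over \<open>m\<close> is a second clique, and \<open>(zero, v)\<close> is used to pass between the
  cliques. The passages alternate in direction, hence their number is even; a vertex over \<open>zero\<close> that
  is left over has to be inserted into an edge of the clique over \<open>one\<close>.
\<close>

fun crossings :: "'c \<Rightarrow> 'm list \<Rightarrow> ('c \<times> 'm) list" where
  "crossings m (x # y # vs) =
    [(one, bar x), (zero, x), (m, bar x), (m, bar y), (zero, y), (one, bar y)] @ crossings m vs"
| "crossings m vs = []"

text \<open>Within a round the step from \<open>bar x\<close> to \<open>bar y\<close> is made in the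
  clique over \<open>m\<close>, and rounds are linked in the clique over \<open>one\<close>, so no
  relation between different entries of \<open>vs\<close> is required.\<close>

lemma crossings:
  assumes m: "m \<in> units" "\<iota> m = m"
  shows "even (length vs) \<Longrightarrow> distinct vs \<Longrightarrow> set vs \<subseteq> M - J \<Longrightarrow>
    distinct (crossings m vs) \<and> successively adj (crossings m vs)
    \<and> set (crossings m vs) = {one, m} \<times> bar ` set vs \<union> {zero} \<times> set vs
    \<and> (crossings m vs = [] \<longleftrightarrow> vs = [])
    \<and> (vs \<noteq> [] \<longrightarrow> fst (hd (crossings m vs)) = one \<and> last (crossings m vs) = (one, bar (last vs)))"
proof (induction vs rule: induct_list012)
  case (3 x y vs)
  have mz: "m \<noteq> zero" "m \<noteq> one" using m units by blast+
  have xy: "x \<in> M - J" "y \<in> M - J" "x \<noteq> y" and vs: "even (length vs)" "distinct vs" "set vs \<subseteq> M - J"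
    using "3.prems" by auto
  let ?c = "crossings m vs"
  from "3.IH"(1)[OF vs] have IH: "distinct ?c" "successively adj ?c"
    "set ?c = {one, m} \<times> bar ` set vs \<union> {zero} \<times> set vs" "?c = [] \<longleftrightarrow> vs = []"
    "vs \<noteq> [] \<Longrightarrow> fst (hd ?c) = one" "vs \<noteq> [] \<Longrightarrow> last ?c = (one, bar (last vs))"
    by auto
  have b: "bar x \<notin> bar ` set vs" "bar y \<notin> bar ` set vs" "bar x \<noteq> bar y"
    using "3.prems"(2) xy vs(3) bar_eq by (auto simp: image_iff)
  have c: "crossings m (x # y # vs) =
    [(one, bar x), (zero, x), (m, bar x), (m, bar y), (zero, y), (one, bar y)] @ ?c" by simp
  have "distinct (crossings m (x # y # vs))"
    unfolding c using IH(1,3) b xy(3) mz zero_one "3.prems"(2) by auto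
  moreover have "adj (one, bar x) (zero, x)" "adj (zero, x) (m, bar x)" "adj (m, bar x) (m, bar y)"
    "adj (m, bar y) (zero, y)" "adj (zero, y) (one, bar y)"
    using xy H_bar mz m b zero_one by (auto simp: adj_def)
  moreover have "adj (one, bar y) (hd ?c)" if "?c \<noteq> []"
  proof -
    have "hd ?c \<in> set ?c" using that by simp
    moreover have "(one, bar y) \<notin> set ?c" using IH(3) b(2) mz zero_one by auto
    ultimately have "hd ?c \<noteq> (one, bar y)" by metis
    then show ?thesis using IH(4,5) that iota_one zero_one by (auto simp: adj_def)
  qed
  ultimately have "successively adj (crossings m (x # y # vs))"
    unfolding c using IH(2)
    by (cases "?c = []") (simp_all add: successively_append_iff successively_Cons)
  moreover have "set (crossings m (x # y # vs)) =
      {one, m} \<times> bar ` set (x # y # vs) \<union> {zero} \<times> set (x # y # vs)"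
    unfolding c using IH(3) by auto
  moreover have "last (crossings m (x # y # vs)) = (one, bar (last (x # y # vs)))"
    unfolding c using IH(4,6) by auto
  ultimately show ?case using \<open>distinct (crossings m (x # y # vs))\<close> unfolding c by simp
qed auto

text \<open>
  The \<open>n\<close> vertices over \<open>units - {m}\<close> go between \<open>(zero, x)\<close> and \<open>(m, bar x)\<close>, and \<open>F\<close> indexes
  vertices over \<open>m\<close> that no crossing uses.
\<close>

lemma crossing_ear:
  assumes m: "m \<in> units" "\<iota> m = m" and free: "\<And>c. c \<in> units \<Longrightarrow> c \<noteq> m \<Longrightarrow> \<iota> c \<noteq> c"
    and vs: "distinct (x # y # vs)" "even (length vs)" "set (x # y # vs) \<subseteq> M - J"
    and n: "even n" "n \<le> card (units - {m}) * card M"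
    and F: "F \<subseteq> M - bar ` set (x # y # vs)"
  shows "\<exists>ys. distinct ys \<and> successively adj ys \<and> ys \<noteq> [] \<and> hd ys = (one, bar x)
    \<and> last ys = (one, bar (last (x # y # vs))) \<and> set ys \<subseteq> V
    \<and> set ys \<inter> K = {one} \<times> bar ` set (x # y # vs)
    \<and> set ys \<inter> {zero} \<times> M = {zero} \<times> set (x # y # vs)
    \<and> card (set ys - K) = 4 + n + card F + 2 * length vs"
proof -
  define Z where "Z = units - {m}"
  have mz: "m \<noteq> zero" "m \<noteq> one" "m \<in> C" using m units by blast+
  have xy: "x \<in> M - J" "y \<in> M - J" "x \<noteq> y" and vs': "distinct vs" "set vs \<subseteq> M - J"
    using vs by auto
  have xyM: "x \<in> M" "y \<in> M" "bar x \<in> M" "bar y \<in> M" "x \<notin> J" "y \<notin> J"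
    using xy bar by blast+
  have fu: "finite units" using fin by (simp add: units_def)
  have Zi: "\<iota> c \<in> Z \<and> \<iota> c \<noteq> c" if "c \<in> Z" for c
    using that units[of c] free[of c] m units[of m] by (auto simp: Z_def)
  have "even (card Z) \<and> (\<forall>n. even n \<and> n \<le> card Z * card M \<longrightarrow>
    (\<exists>xs. distinct xs \<and> successively adj xs \<and> set xs \<subseteq> Z \<times> M \<and> length xs = n
      \<and> (xs \<noteq> [] \<longrightarrow> snd (hd xs) = bar x \<and> snd (last xs) = x)))"
    by (rule segment) (use fu Zi xyM H_bar[OF xy(1)] in \<open>auto simp: Z_def\<close>)
  then obtain zs where zs: "distinct zs" "successively adj zs" "set zs \<subseteq> Z \<times> M" "length zs = n"
    "zs \<noteq> [] \<longrightarrow> snd (hd zs) = bar x \<and> snd (last zs) = x"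
    using n unfolding Z_def[symmetric] by blast
  have fF: "finite F" using F fin by (meson finite_Diff finite_subset)
  then obtain ws where ws: "set ws = F" "distinct ws" using finite_distinct_list by blast
  define fs where "fs = map (Pair m) ws"
  have fs: "set fs = {m} \<times> F" "distinct fs" "length fs = card F"
    using ws distinct_card[OF ws(2)] by (auto simp: fs_def distinct_map inj_on_def)
  have sfs: "successively adj fs"
    unfolding fs_def successively_map using ws(2) mz m
    by (auto simp: successively_conv_nth adj_def nth_eq_iff_index_eq)
  let ?c = "crossings m vs"
  from crossings[OF m vs(2) vs'] have c: "distinct ?c" "successively adj ?c"
    "set ?c = {one, m} \<times> bar ` set vs \<union> {zero} \<times> set vs" "?c = [] \<longleftrightarrow> vs = []"
    "vs \<noteq> [] \<Longrightarrow> fst (hd ?c) = one" "vs \<noteq> [] \<Longrightarrow> last ?c = (one, bar (last vs))"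
    by auto
  have b: "bar x \<notin> bar ` set vs" "bar y \<notin> bar ` set vs" "bar x \<noteq> bar y"
    using vs(1) xy vs'(2) bar_eq by (auto simp: image_iff)
  let ?ys = "[(one, bar x), (zero, x)] @ zs @ [(m, bar x)] @ fs @ [(m, bar y), (zero, y), (one, bar y)] @ ?c"
  have bvs: "bar ` set vs \<subseteq> M" using vs'(2) bar by blast
  have disj: "set zs \<inter> ({zero, one, m} \<times> M) = {}" using zs(3) units by (auto simp: Z_def)
  have F': "F \<subseteq> M" "bar x \<notin> F" "bar y \<notin> F" "F \<inter> bar ` set vs = {}" using F by auto
  have cM: "set ?c \<subseteq> {zero, one, m} \<times> M" using c(3) bvs vs'(2) by auto
  have fM: "set fs \<subseteq> {zero, one, m} \<times> M" using fs(1) F'(1) by auto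
  have d1: "set zs \<inter> set ?c = {}" "set zs \<inter> set fs = {}" using disj cM fM by blast+
  have d2: "set fs \<inter> set ?c = {}" using fs(1) c(3) F'(4) mz by auto
  have d3: "(zero, x) \<notin> set zs" "(zero, y) \<notin> set zs" "(one, bar x) \<notin> set zs" "(one, bar y) \<notin> set zs"
    "(m, bar x) \<notin> set zs" "(m, bar y) \<notin> set zs"
    using disj xyM by blast+
  have d4: "(zero, x) \<notin> set ?c" "(zero, y) \<notin> set ?c" "(one, bar x) \<notin> set ?c" "(one, bar y) \<notin> set ?c"
    "(m, bar x) \<notin> set ?c" "(m, bar y) \<notin> set ?c"
    using c(3) b vs(1) mz zero_one by auto
  have d5: "(zero, x) \<notin> set fs" "(zero, y) \<notin> set fs" "(one, bar x) \<notin> set fs" "(one, bar y) \<notin> set fs"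
    "(m, bar x) \<notin> set fs" "(m, bar y) \<notin> set fs"
    using fs(1) F' mz by auto
  have "distinct ?ys"
    using zs(1) fs(2) c(1) d1 d2 d3 d4 d5 b(3) xy(3) mz zero_one by auto
  moreover have "successively adj ?ys"
  proof -
    have l1: "adj (zero, x) (hd zs)" if "zs \<noteq> []"
      using that zs(5) H_bar[OF xy(1)] hd_in_set[OF that] d3(1)
      by (cases "hd zs") (auto simp: adj_def)
    have l2: "adj (last zs) (m, bar x)" if "zs \<noteq> []"
      using that zs(5) H_bar[OF xy(1)] last_in_set[OF that] d3(5)
      by (cases "last zs") (auto simp: adj_def)
    have l3: "adj (m, bar x) (hd fs)" if "fs \<noteq> []"
      using that fs(1) hd_in_set[OF that] d5(5) m mz
      by (cases "hd fs") (auto simp: adj_def)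
    have l4: "adj (last fs) (m, bar y)" if "fs \<noteq> []"
      using that fs(1) last_in_set[OF that] d5(6) m mz
      by (cases "last fs") (auto simp: adj_def)
    have l5: "adj (one, bar y) (hd ?c)" if "?c \<noteq> []"
      using that c(4,5) hd_in_set[OF that] d4(4) iota_one zero_one
      by (cases "hd ?c") (auto simp: adj_def)
    have "adj (one, bar x) (zero, x)" "adj (zero, x) (m, bar x)" "adj (m, bar x) (m, bar y)"
      "adj (m, bar y) (zero, y)" "adj (zero, y) (one, bar y)"
      using xy H_bar mz m b zero_one by (auto simp: adj_def)
    then show ?thesis
      using l1 l2 l3 l4 l5 zs(2) sfs c(2)
      by (cases "zs = []"; cases "fs = []") (auto simp: successively_append_iff successively_Cons)
  qed
  moreover have V: "set ?ys \<subseteq> V"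
  proof -
    have "set zs \<subseteq> V" using zs(3) units by (auto simp: V_def Z_def)
    moreover have "set ?c \<subseteq> V" using c(3) bvs vs'(2) one mz zero zero_one by (auto simp: V_def)
    moreover have "set fs \<subseteq> V" using fs(1) F'(1) mz by (auto simp: V_def)
    ultimately show ?thesis using xyM one mz zero zero_one by (auto simp: V_def)
  qed
  moreover have "set ?ys \<inter> K = {one} \<times> bar ` set (x # y # vs)"
  proof -
    have "set zs \<inter> K = {}" using disj by (auto simp: K_def)
    moreover have "set fs \<inter> K = {}" using fs(1) mz by (auto simp: K_def)
    moreover have "set ?c \<inter> K = {one} \<times> bar ` set vs" using c(3) bvs mz zero_one by (auto simp: K_def)
    ultimately show ?thesis using xyM mz zero_one by (auto simp: K_def)
  qed
  moreover have "set ?ys \<inter> {zero} \<times> M = {zero} \<times> set (x # y # vs)"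
  proof -
    have "set zs \<inter> {zero} \<times> M = {}" using disj by auto
    moreover have "set fs \<inter> {zero} \<times> M = {}" using fs(1) mz by auto
    moreover have "set ?c \<inter> {zero} \<times> M = {zero} \<times> set vs" using c(3) vs'(2) mz zero_one by auto
    ultimately show ?thesis using xyM mz zero_one by auto
  qed
  moreover have "card (set ?ys - K) = 4 + n + card F + 2 * length vs"
  proof -
    have cl: "length ?c = 3 * length vs"
      using vs(2) by (induction vs rule: induct_list012) auto
    have "length ?ys = 6 + n + card F + 3 * length vs" using zs(4) fs(3) cl by simp
    moreover have "card (set ?ys) = length ?ys" using \<open>distinct ?ys\<close> by (rule distinct_card)
    moreover have "card ({one} \<times> bar ` set (x # y # vs)) = 2 + length vs"
    proof -
      have "inj_on bar (set (x # y # vs))" using vs(3) bar_inj inj_on_subset by blast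
      then show ?thesis using distinct_card[OF vs(1)]
        by (simp add: card_cartesian_product card_image del: image_insert list.set)
    qed
    ultimately show ?thesis
      using card_Diff_subset_Int[of "set ?ys" K] \<open>set ?ys \<inter> K = _\<close> by (simp del: image_insert list.set set_append)
  qed
  moreover have "?ys \<noteq> []" "hd ?ys = (one, bar x)" by simp_all
  moreover have "last ?ys = (one, bar (last (x # y # vs)))" using c(4,6) by simp
  ultimately show ?thesis by - (intro exI[of _ ?ys] conjI; assumption)
qed

text \<open>The parity assumption matters only when every vertex over \<open>zero\<close> is to be
  used. If their number is odd, one vertex \<open>(zero, v)\<close> remains uncrossed; it is a
  neighbour of \<open>(one, bar v)\<close>, and \<open>H x v\<close> with
  \<open>x \<noteq> bar v\<close> supplies the second clique neighbour
  \<open>(one, x)\<close>.\<close>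

lemma pancyclic_involution:
  assumes m: "m \<in> units" "\<iota> m = m" and free: "\<And>c. c \<in> units \<Longrightarrow> c \<noteq> m \<Longrightarrow> \<iota> c \<noteq> c"
    and parity: "even (card (M - J)) \<or> (\<exists>v\<in>M - J. \<exists>x\<in>M - J. x \<noteq> bar v \<and> H x v)"
  shows "pancyclic_on adj V"
proof (rule pancyclic_on_V)
  fix t assume t: "1 \<le> t" "t \<le> card (M - J) + card units * card M"
  have mz: "m \<noteq> zero" "m \<noteq> one" "m \<in> C" using m units by blast+
  define p where "p = card (units - {m}) * card M"
  have fu: "finite units" using fin by (simp add: units_def)
  have "card units = Suc (card (units - {m}))" using m(1) fu by (metis card.remove)
  then have total: "card units * card M = p + card M" by (simp add: p_def)
  have fN: "finite (M - J)" using fin by simp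
  obtain x y where xy: "x \<in> M - J" "y \<in> M - J" "x \<noteq> y" by (rule two_elements)
  have pev: "even p"
  proof -
    have "even (card (units - {m}))"
    proof (rule segment[THEN conjunct1])
      show "finite (units - {m})" using fu by simp
      show "\<iota> c \<in> units - {m} \<and> \<iota> c \<noteq> c" if "c \<in> units - {m}" for c
        using that units[of c] free[of c] m units[of m] by auto
      show "x \<in> M" "bar x \<in> M" "H (bar x) x" using xy bar H_bar by blast+
    qed simp
    then show ?thesis by (simp add: p_def)
  qed
  have build: "\<exists>ys. ear adj V K ys \<and> card (set ys - K) = 4 + n + card F + 2 * length vs"
    if vs: "distinct (x # y # vs)" "even (length vs)" "set (x # y # vs) \<subseteq> M - J"
      and n: "even n" "n \<le> p" and F: "F \<subseteq> M - bar ` set (x # y # vs)" for x y vs n F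
  proof -
    obtain ys where ys: "distinct ys \<and> successively adj ys \<and> ys \<noteq> [] \<and> hd ys = (one, bar x)
      \<and> last ys = (one, bar (last (x # y # vs))) \<and> set ys \<subseteq> V
      \<and> set ys \<inter> K = {one} \<times> bar ` set (x # y # vs)
      \<and> set ys \<inter> {zero} \<times> M = {zero} \<times> set (x # y # vs)
      \<and> card (set ys - K) = 4 + n + card F + 2 * length vs"
      using crossing_ear[OF m free vs n(1) n(2)[unfolded p_def] F] by (rule exE)
    have sub: "bar ` set (x # y # vs) \<subseteq> M - J" using vs(3) bar by blast
    have l: "last (x # y # vs) \<in> set (y # vs)" by (cases vs) auto
    then have "last (x # y # vs) \<noteq> x" using vs(1) by auto
    moreover have "x \<in> M - J" "last (x # y # vs) \<in> M - J" using l vs(3) by auto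
    ultimately have "bar x \<noteq> bar (last (x # y # vs))"
      using bar_eq[of x "last (x # y # vs)"] by metis
    moreover have "bar x \<in> M" "bar (last (x # y # vs)) \<in> M"
      using bar[OF \<open>x \<in> M - J\<close>] bar[OF \<open>last (x # y # vs) \<in> M - J\<close>] by simp_all
    moreover have "\<not> K \<subseteq> set ys"
    proof
      assume "K \<subseteq> set ys"
      moreover have "set ys \<inter> K = {one} \<times> bar ` set (x # y # vs)" by (simp only: ys)
      ultimately have "K = {one} \<times> bar ` set (x # y # vs)" by (simp only: inf.absorb2)
      then have "K \<subseteq> {one} \<times> (M - J)" using sub by (simp only: Sigma_mono)
      then show False using J by (auto simp: K_def)
    qed
    ultimately have "ear adj V K ys" unfolding ear_def by (simp add: ys K_def)
    moreover have "card (set ys - K) = 4 + n + card F + 2 * length vs" by (simp only: ys)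
    ultimately show ?thesis by blast
  qed
  \<comment> \<open>The supplies are exhausted in turn: four vertices from two crossings, then
    \<open>p\<close> over the classes other than \<open>m\<close>, then the other
    \<open>card M - 2\<close> over \<open>m\<close>, and finally further vertices over
    \<open>zero\<close>.\<close>
  consider "t \<le> 2" | "3 \<le> t" "t \<le> 4 + p" | "4 + p < t" "t \<le> 2 + card M + p"
    | "2 + card M + p < t" by linarith
  then show "\<exists>ys. ear adj V K ys \<and> (card (set ys - K) = t \<or> card (set ys - K) = Suc t)"
  proof cases
    case 1
    have xyM: "x \<in> M" "y \<in> M" "bar x \<in> M" "bar y \<in> M" "bar x \<in> M - J" "bar y \<in> M - J" "bar x \<noteq> bar y"
      using xy bar bar_eq by blast+
    \<comment> \<open>For the smallest values the path goes directly between the fibres over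
      \<open>one\<close> and \<open>m\<close> and avoids \<open>zero\<close>.\<close>
    let ?ys = "[(one, bar x), (m, x), (m, y), (one, bar y)]"
    have "successively adj ?ys"
      using m mz xy H_bar[OF xy(1)] H_bar[OF xy(2)] by (auto simp: adj_def)
    moreover have "\<not> K \<subseteq> set ?ys"
    proof -
      obtain j where "j \<in> J" using J by blast
      then have "(one, j) \<in> K" "(one, j) \<notin> set ?ys" using J xyM mz by (auto simp: K_def)
      then show ?thesis by blast
    qed
    ultimately have "ear adj V K ?ys"
      using xyM xy mz one zero_one by (auto simp: ear_def K_def V_def)
    moreover have "set ?ys - K = {(m, x), (m, y)}" using xyM mz by (auto simp: K_def)
    then have "card (set ?ys - K) = 2" using xy by simp
    ultimately show ?thesis using t(1) 1 by (intro exI[of _ ?ys]) auto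
  next
    case 2
    define n where "n = (if even t then t - 4 else t - 3)"
    have n: "even n" "n \<le> p" "4 + n = t \<or> 4 + n = Suc t"
      using 2 pev unfolding n_def by presburger+
    have "\<exists>ys. ear adj V K ys \<and> card (set ys - K) = 4 + n + card ({} :: 'm set) + 2 * length ([] :: 'm list)"
      by (rule build[OF _ _ _ n(1,2)]) (use xy in auto)
    then show ?thesis using n(3) by auto
  next
    case 3
    have "card {bar x, bar y} = 2" using xy bar_eq by simp
    moreover have "{bar x, bar y} \<subseteq> M" using xy bar by blast
    ultimately have "card (M - {bar x, bar y}) = card M - 2" using fin by (simp add: card_Diff_subset)
    then have "t - 4 - p \<le> card (M - {bar x, bar y})" using 3 by simp
    then obtain F where F: "F \<subseteq> M - {bar x, bar y}" "card F = t - 4 - p"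
      using obtain_subset_with_card_n by metis
    have "\<exists>ys. ear adj V K ys \<and> card (set ys - K) = 4 + p + card F + 2 * length ([] :: 'm list)"
      by (rule build[OF _ _ _ pev le_refl]) (use xy F in auto)
    then show ?thesis using F(2) 3 by auto
  next
    case 4
    define d where "d = t - card M - p"
    have d: "3 \<le> d" "d \<le> card (M - J)" "t = d + card M + p"
      using 4 t total by (auto simp: d_def)
    have cF: "card (M - bar ` set l) + length l = card M" if "distinct l" "set l \<subseteq> M - J" for l
    proof -
      have "inj_on bar (set l)" using bar_inj inj_on_subset that(2) by blast
      then have "card (bar ` set l) = length l" using that(1) by (simp add: card_image distinct_card)
      moreover have "bar ` set l \<subseteq> M" using that(2) bar by blast
      ultimately show ?thesis using fin
        by (metis (no_types, lifting) List.finite_set card_Diff_subset card_mono finite_imageI le_add_diff_inverse2)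
    qed
    show ?thesis
    proof (cases "even d \<or> d < card (M - J)")
      case True
      define k where "k = (if even d then d else d + 1)"
      have k: "even k" "4 \<le> k" "k \<le> card (M - J)" "k = d \<or> k = Suc d"
        using d True unfolding k_def by presburger+
      obtain l where l: "distinct l" "set l \<subseteq> M - J" "length l = k"
        using distinct_list_hd[OF fN xy(1), of k] k(2,3) by auto
      then obtain x' y' vs where l': "l = x' # y' # vs"
        using k(2) by (cases l; cases "tl l") auto
      have "\<exists>ys. ear adj V K ys \<and> card (set ys - K) = 4 + p + card (M - bar ` set l) + 2 * length vs"
        by (rule build[OF _ _ _ pev le_refl]) (use l l' k in auto)
      moreover have "4 + p + card (M - bar ` set l) + 2 * length vs = k + card M + p"
        using cF[OF l(1,2)] l(3) l' by simp
      ultimately show ?thesis using d(3) k(4) by auto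
    next
      case False
      then have odd: "odd (card (M - J))" "d = card (M - J)" using d by auto
      then obtain v w where vw: "v \<in> M - J" "w \<in> M - J" "w \<noteq> bar v" "H w v" using parity by blast
      have bw: "bar w \<in> M - J" "bar w \<noteq> v" "bar (bar w) = w"
        using bar[OF vw(2)] vw(3) by auto
      have "card (M - J - {v}) = card (M - J) - 1" using vw(1) fN by simp
      then have "\<exists>ls. distinct ls \<and> set ls \<subseteq> M - J - {v} \<and> length ls = card (M - J) - 1 \<and> hd ls = bar w"
        using bw fN d by (intro distinct_list_hd) auto
      then obtain ls where ls: "distinct ls" "set ls \<subseteq> M - J - {v}" "length ls = card (M - J) - 1"
        "hd ls = bar w" by blast
      \<comment> \<open>After reversal \<open>bar w\<close> is crossed last, so the path ends at
        \<open>(one, bar (bar w)) = (one, w)\<close>, from which \<open>H w v\<close> leads on to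
        \<open>(zero, v)\<close>.\<close>
      define l where "l = rev ls"
      have l: "distinct l" "set l \<subseteq> M - J - {v}" "length l = card (M - J) - 1" "last l = bar w"
        using ls by (auto simp: l_def last_rev)
      have lk: "even (length l)" "2 \<le> length l" using l(3) odd(1) odd(2) d(1) by auto
      then obtain x' y' vs where l': "l = x' # y' # vs" by (cases l; cases "tl l") auto
      have lJ: "set l \<subseteq> M - J" using l(2) by blast
      have h: "distinct (x' # y' # vs)" "even (length vs)" "set (x' # y' # vs) \<subseteq> M - J"
        using l(1) lJ lk l' by auto
      obtain ys where ys: "distinct ys \<and> successively adj ys \<and> ys \<noteq> [] \<and> hd ys = (one, bar x')
        \<and> last ys = (one, bar (last (x' # y' # vs))) \<and> set ys \<subseteq> V
        \<and> set ys \<inter> K = {one} \<times> bar ` set (x' # y' # vs)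
        \<and> set ys \<inter> {zero} \<times> M = {zero} \<times> set (x' # y' # vs)
        \<and> card (set ys - K) = 4 + p + card (M - bar ` set l) + 2 * length vs"
        using crossing_ear[OF m free h pev p_def[THEN eq_imp_le] subset_refl] unfolding l' by (rule exE)
      have ys1: "distinct ys" "successively adj ys" "ys \<noteq> []" "hd ys = (one, bar x')" "last ys = (one, w)"
        "set ys \<subseteq> V" "set ys \<inter> K = {one} \<times> bar ` set l" "set ys \<inter> {zero} \<times> M = {zero} \<times> set l"
        "card (set ys - K) = 4 + p + card (M - bar ` set l) + 2 * length vs"
        by (simp_all only: ys l(4)[unfolded l'] bw(3) l' simp_thms)
      have x': "x' \<in> M - J" "x' \<noteq> v" using l(2) l' by auto
      have bv: "bar v \<in> M - J" "bar x' \<noteq> bar v" "bar x' \<in> M"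
        using x'(2) bar[OF vw(1)] bar[OF x'(1)] bar_eq[OF x'(1) vw(1)] by auto
      have "bar v \<notin> bar ` set l" using lJ l(2) bar_eq[OF vw(1)] by (fastforce simp: image_iff)
      then have n1: "(one, bar v) \<notin> set ys" using ys1(7) bv(1) by (auto simp: K_def)
      have n0: "(zero, v) \<notin> set ys" using ys1(8) l(2) vw(1) by auto
      let ?ys = "ys @ [(zero, v), (one, bar v)]"
      have "distinct ?ys" using ys1(1) n0 n1 zero_one by auto
      moreover have "adj (one, w) (zero, v)" "adj (zero, v) (one, bar v)"
        using vw(4) H_bar[OF vw(1)] zero_one by (auto simp: adj_def)
      then have "successively adj ?ys" using ys1(2,5) by (simp add: successively_append_iff)
      moreover have "set ?ys \<subseteq> V" using ys1(6) vw(1) bv(1) zero one zero_one by (auto simp: V_def)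
      moreover have "\<not> K \<subseteq> set ?ys"
      proof -
        obtain j where j: "j \<in> J" using J by blast
        have K: "(one, j) \<in> K" using j J by (auto simp: K_def)
        have "bar ` set l \<subseteq> M - J" using lJ bar by blast
        then have "(one, j) \<notin> set ys \<inter> K" unfolding ys1(7) using j by blast
        then have "(one, j) \<notin> set ?ys" using K j bv zero_one by auto
        with K have "(one, j) \<in> K" "(one, j) \<notin> set ?ys" by simp_all
        then show ?thesis by blast
      qed
      ultimately have "ear adj V K ?ys" using ys1(3,4) bv by (simp add: ear_def K_def)
      moreover have "set ?ys - K = insert (zero, v) (set ys - K)"
        using bv(1) zero_one by (auto simp: K_def)
      then have "card (set ?ys - K) = Suc (card (set ys - K))" using n0 by simp
      moreover have "card (set ys - K) = card M + p + length l"
        using ys1(9) cF[OF l(1) lJ] l' by simp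
      ultimately have "ear adj V K ?ys \<and> card (set ?ys - K) = t"
        using l(3) odd(2) d by simp
      then show ?thesis by blast
    qed
  qed
qed

end

section \<open>Maximal ideals of a finite ring\<close>

locale finite_cring = cring R for R (structure) +
  assumes fin: "finite (carrier R)" and nontrivial: "\<one> \<noteq> \<zero>"
begin

text \<open>One exponent that makes every power idempotent. By the pigeonhole principle the powers
  of any element become periodic with preperiod and period at most \<open>card (carrier R)\<close>;
  the factorial is at least the former and a multiple of the latter.\<close>

definition expo :: nat where
  "expo = fact (card (carrier R))"

lemma expo_ge_2: "2 \<le> expo"
proof -
  have "{\<zero>, \<one>} \<subseteq> carrier R" by auto
  then have "card {\<zero>, \<one>} \<le> card (carrier R)" using fin by (metis card_mono)
  then have "2 \<le> card (carrier R)" using nontrivial by auto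
  then show ?thesis unfolding expo_def using fact_ge_self le_trans by blast
qed

lemma pow_expo_idem:
  assumes x: "x \<in> carrier R"
  shows "x [^] expo \<otimes> x [^] expo = x [^] expo"
proof -
  define n where "n = card (carrier R)"
  have "\<not> inj_on (\<lambda>i::nat. x [^] i) {..n}"
  proof
    assume "inj_on (\<lambda>i::nat. x [^] i) {..n}"
    moreover have "(\<lambda>i::nat. x [^] i) ` {..n} \<subseteq> carrier R" using x by auto
    ultimately have "card {..n} \<le> card (carrier R)" using fin card_inj_on_le by blast
    then show False by (simp add: n_def)
  qed
  then obtain i j :: nat where ij: "i < j" "j \<le> n" "x [^] i = x [^] j"
    unfolding inj_on_def by (metis atMost_iff linorder_neqE_nat)
  define d where "d = j - i"
  have d: "1 \<le> d" "d \<le> n" using ij by (auto simp: d_def)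
  have step: "x [^] (k + d) = x [^] k" if "i \<le> k" for k
  proof -
    have "x [^] (k + d) = x [^] (k - i) \<otimes> x [^] j"
      using x that ij(1) by (simp add: nat_pow_mult d_def)
    also have "\<dots> = x [^] (k - i) \<otimes> x [^] i" using ij by simp
    also have "\<dots> = x [^] k" using x that by (simp add: nat_pow_mult)
    finally show ?thesis .
  qed
  have steps: "x [^] (k + q * d) = x [^] k" if "i \<le> k" for k q
  proof (induction q)
    case (Suc q)
    have "x [^] (k + Suc q * d) = x [^] ((k + q * d) + d)" by (simp add: algebra_simps)
    then show ?case using Suc step[of "k + q * d"] that by simp
  qed simp
  have "d dvd expo" using d by (simp add: expo_def n_def dvd_fact)
  then obtain q where q: "expo = q * d" by (metis dvd_def mult.commute)
  have "i \<le> expo" using ij fact_ge_self[of n] by (simp add: expo_def n_def)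
  then have "x [^] (expo + q * d) = x [^] expo" by (rule steps)
  then show ?thesis using x q by (simp add: nat_pow_mult)
qed

text \<open>
  Writing \<open>R\<close> as a product of local rings, \<open>ginv\<close> inverts the unit components and fixes the
  nilpotent ones: \<open>x [^] expo\<close> is the idempotent that selects the unit components.
\<close>

definition ginv :: "'a \<Rightarrow> 'a" where
  "ginv x = x [^] (2 * expo - 1) \<oplus> x \<otimes> (\<one> \<ominus> x [^] expo)"

lemma ginv_closed [simp]: "x \<in> carrier R \<Longrightarrow> ginv x \<in> carrier R"
  by (simp add: ginv_def)

lemma idem_pow:
  assumes "e \<in> carrier R" "e \<otimes> e = e" "1 \<le> (n::nat)"
  shows "e [^] n = e"
  using assms(3)
proof (induction n rule: dec_induct)
  case (step n)
  then show ?case using assms(1,2) by simp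
qed (use assms in simp)

lemma orthogonal_pow_add:
  assumes "f \<in> carrier R" "g \<in> carrier R" "f \<otimes> g = \<zero>" "1 \<le> (n::nat)"
  shows "(f \<oplus> g) [^] n = f [^] n \<oplus> g [^] n"
  using assms(4)
proof (induction n rule: dec_induct)
  case (step n)
  have z: "f [^] n \<otimes> g = \<zero>" "g [^] n \<otimes> f = \<zero>"
  proof -
    have "f [^] n = f [^] (n - 1) \<otimes> f" "g [^] n = g [^] (n - 1) \<otimes> g"
      using step(1) by (metis Suc_diff_1 One_nat_def Suc_le_eq nat_pow_Suc)+
    then show "f [^] n \<otimes> g = \<zero>" "g [^] n \<otimes> f = \<zero>"
      using assms(1-3) by (simp_all add: m_assoc m_comm[of g f])
  qed
  show ?case using step assms(1,2) z by (simp add: l_distr r_distr)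
qed (use assms in simp)

text \<open>\<open>ginv x\<close> splits into orthogonal parts: \<open>f\<close> inverts
  \<open>x\<close> on the component cut out by the idempotent \<open>e\<close>, and \<open>x\<close>
  times \<open>1 - e\<close> is the rest. The exponent \<open>2 * expo - 1\<close> makes
  \<open>f\<close> a multiple of \<open>e\<close>.\<close>

lemma ginv_parts:
  assumes x: "x \<in> carrier R"
  defines "e \<equiv> x [^] expo" and "f \<equiv> x [^] (2 * expo - 1)"
  shows "f \<otimes> (x \<otimes> (\<one> \<ominus> e)) = \<zero>" "f \<otimes> x = e" "e \<otimes> f = f" "e \<otimes> e = e"
proof -
  have e: "e \<in> carrier R" "e \<otimes> e = e" using x pow_expo_idem by (simp_all add: e_def)
  have f: "f \<in> carrier R" using x by (simp add: f_def)
  show ee: "e \<otimes> e = e" by (fact e)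
  have "f \<otimes> x = x [^] Suc (2 * expo - 1)" using x by (simp add: f_def)
  also have "Suc (2 * expo - 1) = expo + expo" using expo_ge_2 by simp
  finally show fx: "f \<otimes> x = e" using e x by (simp add: e_def nat_pow_mult)
  have "f \<otimes> (x \<otimes> (\<one> \<ominus> e)) = e \<otimes> (\<one> \<ominus> e)"
    using fx e f x by (simp add: m_assoc[symmetric])
  also have "\<dots> = e \<ominus> e \<otimes> e" using e(1) by algebra
  finally show "f \<otimes> (x \<otimes> (\<one> \<ominus> e)) = \<zero>" using e by (simp add: r_right_minus_eq)
  have "f = x [^] (expo - 1) \<otimes> e"
    using x expo_ge_2 by (simp add: f_def e_def nat_pow_mult mult_2 add.commute)
  then show "e \<otimes> f = f" using e x m_lcomm[of e "x [^] (expo - 1)" e] by simp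
qed

lemma ginv_ginv:
  assumes x: "x \<in> carrier R"
  shows "ginv (ginv x) = x"
proof -
  define e where "e = x [^] expo"
  define f where "f = x [^] (2 * expo - 1)"
  define g where "g = x \<otimes> (\<one> \<ominus> e)"
  note parts = ginv_parts[OF x, folded e_def f_def]
  have cl: "e \<in> carrier R" "f \<in> carrier R" "g \<in> carrier R" using x by (simp_all add: e_def f_def g_def)
  have w: "ginv x = f \<oplus> g" by (simp add: ginv_def e_def f_def g_def)
  have fg: "f \<otimes> g = \<zero>" using parts by (simp add: g_def)
  have idem1: "(\<one> \<ominus> e) \<otimes> (\<one> \<ominus> e) = \<one> \<ominus> e"
  proof -
    have "(\<one> \<ominus> e) \<otimes> (\<one> \<ominus> e) = \<one> \<ominus> e \<ominus> e \<oplus> e \<otimes> e" using cl by algebra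
    then show ?thesis using cl parts(4) by algebra
  qed
  have ee: "e \<otimes> (\<one> \<ominus> e) = \<zero>"
  proof -
    have "e \<otimes> (\<one> \<ominus> e) = e \<ominus> e \<otimes> e" using cl by algebra
    then show ?thesis using cl parts(4) by (simp add: r_right_minus_eq)
  qed
  have gN: "g [^] expo = \<zero>"
    using x cl idem_pow[OF _ idem1, of expo] expo_ge_2 ee
    by (simp add: g_def nat_pow_distrib e_def[symmetric])
  have fN: "f [^] expo = e"
  proof -
    have "f [^] expo = e [^] (2 * expo - 1)"
      using x by (simp add: f_def e_def nat_pow_pow mult.commute)
    then show ?thesis using idem_pow[OF cl(1) parts(4)] expo_ge_2 by simp
  qed
  have wN: "ginv x [^] expo = e"
    unfolding w using orthogonal_pow_add[OF cl(2,3) fg, of expo] expo_ge_2 fN gN cl by simp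
  have f2: "f [^] (2 * expo - 1) = x \<otimes> e"
  proof -
    obtain n where n: "expo = Suc n" "1 \<le> n" using expo_ge_2 by (cases expo) auto
    \<comment> \<open>The exponent is \<open>1\<close> modulo \<open>expo\<close>, so this power of
      \<open>x\<close> is \<open>x\<close> times a power of the idempotent \<open>e\<close>.\<close>
    have "(2 * expo - 1) * (2 * expo - 1) = 1 + expo * (4 * n)"
      unfolding n(1) by (simp add: algebra_simps)
    then have "f [^] (2 * expo - 1) = x [^] (1 + expo * (4 * n))"
      using x by (simp add: f_def nat_pow_pow)
    also have "\<dots> = x \<otimes> e [^] (4 * n)"
      using x by (simp add: e_def nat_pow_pow nat_pow_mult[symmetric] m_comm)
    finally show ?thesis using idem_pow[OF cl(1) parts(4), of "4 * n"] n(2) by simp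
  qed
  have g2: "g [^] (2 * expo - 1) = \<zero>"
  proof -
    have "2 * expo - 1 = expo + (expo - 1)" using expo_ge_2 by simp
    then have "g [^] (2 * expo - 1) = g [^] expo \<otimes> g [^] (expo - 1)"
      using cl by (simp add: nat_pow_mult)
    then show ?thesis using gN cl by simp
  qed
  have w2: "ginv x [^] (2 * expo - 1) = x \<otimes> e"
    unfolding w using orthogonal_pow_add[OF cl(2,3) fg, of "2 * expo - 1"] expo_ge_2 f2 g2 cl x by simp
  have "g \<otimes> (\<one> \<ominus> e) = g" using x cl idem1 by (simp add: g_def m_assoc)
  moreover have "f \<otimes> (\<one> \<ominus> e) = f \<ominus> e \<otimes> f" using cl by algebra
  then have "f \<otimes> (\<one> \<ominus> e) = \<zero>" using parts(3) cl by (simp add: r_right_minus_eq)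
  ultimately have "ginv x \<otimes> (\<one> \<ominus> e) = g" unfolding w using cl by (simp add: l_distr)
  then have "ginv (ginv x) = x \<otimes> e \<oplus> g" using w2 wN by (simp add: ginv_def[of "ginv x"])
  also have "\<dots> = x" unfolding g_def using x cl by algebra
  finally show ?thesis .
qed

section \<open>Membership in maximal ideals and separation by idempotents\<close>

lemma maximal_ideal: "maximalideal P R \<Longrightarrow> ideal P R"
  by (simp add: maximalideal_def)

lemma maximal_sub: "maximalideal P R \<Longrightarrow> x \<in> P \<Longrightarrow> x \<in> carrier R"
  by (meson additive_subgroup.a_Hcarr ideal.axioms(1) maximal_ideal)

lemma maximal_one: "maximalideal P R \<Longrightarrow> \<one> \<notin> P"
  using ideal.one_imp_carrier maximal_ideal maximalideal.I_notcarr by metis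

lemma maximal_prime:
  "maximalideal P R \<Longrightarrow> x \<in> carrier R \<Longrightarrow> y \<in> carrier R \<Longrightarrow> x \<otimes> y \<in> P \<longleftrightarrow> x \<in> P \<or> y \<in> P"
  by (meson ideal.I_l_closed ideal.I_r_closed maximal_ideal maximalideal_prime primeideal.I_prime)

lemma maximal_add: "maximalideal P R \<Longrightarrow> x \<in> P \<Longrightarrow> y \<in> P \<Longrightarrow> x \<oplus> y \<in> P"
  by (meson additive_subgroup.a_closed ideal.axioms(1) maximal_ideal)

lemma maximal_minus: "maximalideal P R \<Longrightarrow> x \<in> P \<Longrightarrow> y \<in> P \<Longrightarrow> x \<ominus> y \<in> P"
  by (metis a_minus_def additive_subgroup.a_closed additive_subgroup.a_inv_closed ideal.axioms(1) maximal_ideal)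

lemma maximal_zero: "maximalideal P R \<Longrightarrow> \<zero> \<in> P"
  by (meson additive_subgroup.zero_closed ideal.axioms(1) maximal_ideal)

lemma maximal_pow:
  "maximalideal P R \<Longrightarrow> x \<in> carrier R \<Longrightarrow> x \<notin> P \<Longrightarrow> x [^] (n::nat) \<notin> P"
  by (induction n) (auto simp: maximal_one maximal_prime)

lemma maximal_not_unit: "maximalideal P R \<Longrightarrow> x \<in> P \<Longrightarrow> x \<notin> Units R"
proof
  assume P: "maximalideal P R" "x \<in> P" and "x \<in> Units R"
  then have "x \<otimes> inv x \<in> P" using maximal_prime[of P x "inv x"] maximal_sub by simp
  then show False using \<open>x \<in> Units R\<close> maximal_one[OF P(1)] by simp
qed

lemma maximal_idem:
  assumes "maximalideal P R" "e \<in> carrier R" "e \<otimes> e = e" "e \<notin> P"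
  shows "\<one> \<ominus> e \<in> P"
proof -
  have "e \<otimes> (\<one> \<ominus> e) = e \<ominus> e \<otimes> e" using assms(2) by algebra
  then have "e \<otimes> (\<one> \<ominus> e) = \<zero>" using assms(2,3) by (simp add: r_right_minus_eq)
  then show ?thesis
    using maximal_prime[OF assms(1,2), of "\<one> \<ominus> e"] maximal_zero[OF assms(1)] assms(2,4) by simp
qed

text \<open>In each residue field \<open>ginv\<close> acts as inversion extended by \<open>0\<close>
  at \<open>0\<close>. Outside \<open>P\<close> the idempotent \<open>x [^] expo\<close> is
  \<open>1\<close> modulo \<open>P\<close>, and \<open>\<one> \<ominus> x \<otimes> ginv x\<close>
  is a multiple of its complement. Together with \<open>ginv_ginv\<close> this makes
  \<open>ginv\<close> a matching on \<open>M - J\<close>.\<close>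

lemma ginv_maximal:
  assumes P: "maximalideal P R" and x: "x \<in> carrier R"
  shows "x \<notin> P \<Longrightarrow> \<one> \<ominus> x \<otimes> ginv x \<in> P" "x \<in> P \<Longrightarrow> ginv x \<in> P"
proof -
  define e where "e = x [^] expo"
  define f where "f = x [^] (2 * expo - 1)"
  note parts = ginv_parts[OF x, folded e_def f_def]
  have cl: "e \<in> carrier R" "f \<in> carrier R" using x by (simp_all add: e_def f_def)
  have w: "ginv x = f \<oplus> x \<otimes> (\<one> \<ominus> e)" by (simp add: ginv_def e_def f_def)
  show "\<one> \<ominus> x \<otimes> ginv x \<in> P" if "x \<notin> P"
  proof -
    have "\<one> \<ominus> e \<in> P"
      using maximal_idem[OF P cl(1) parts(4)] maximal_pow[OF P x that] by (simp add: e_def)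
    moreover have "\<one> \<ominus> x \<otimes> ginv x = (\<one> \<ominus> e) \<otimes> (\<one> \<ominus> x \<otimes> x)"
    proof -
      have "\<one> \<ominus> x \<otimes> ginv x = \<one> \<ominus> (f \<otimes> x \<oplus> x \<otimes> x \<otimes> (\<one> \<ominus> e))"
        unfolding w using x cl by algebra
      also have "\<dots> = (\<one> \<ominus> e) \<otimes> (\<one> \<ominus> x \<otimes> x)" unfolding parts(2) using x cl by algebra
      finally show ?thesis .
    qed
    ultimately show ?thesis using maximal_prime[OF P] x cl by simp
  qed
  show "ginv x \<in> P" if "x \<in> P"
  proof -
    have "2 * expo - 1 = Suc (2 * expo - 2)" using expo_ge_2 by simp
    then have "f = x [^] (2 * expo - 2) \<otimes> x" by (simp add: f_def)
    then have "f \<in> P" using maximal_prime[OF P] x that by simp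
    moreover have "x \<otimes> (\<one> \<ominus> e) \<in> P" using maximal_prime[OF P] x that cl by simp
    ultimately show ?thesis unfolding w by (rule maximal_add[OF P])
  qed
qed

lemma ex_maximal: "\<exists>P. maximalideal P R"
proof -
  define S where "S = {I. ideal I R \<and> \<one> \<notin> I}"
  have sub: "I \<subseteq> carrier R" if "ideal I R" for I
    using that additive_subgroup.a_subset ideal.axioms(1) by blast
  have "S \<subseteq> Pow (carrier R)" using sub by (auto simp: S_def)
  then have "finite S" using fin finite_subset by blast
  moreover have "{\<zero>} \<in> S" using zeroideal nontrivial by (simp add: S_def)
  ultimately obtain I where I: "I \<in> S" "\<And>L. L \<in> S \<Longrightarrow> I \<subseteq> L \<Longrightarrow> L = I"
    using finite_has_maximal2[of S] by metis
  have "maximalideal I R"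
  proof (rule maximalidealI)
    show "ideal I R" using I by (simp add: S_def)
    show "carrier R \<noteq> I" using I(1) by (auto simp: S_def)
    fix L assume L: "ideal L R" "I \<subseteq> L" "L \<subseteq> carrier R"
    show "L = I \<or> L = carrier R"
    proof (cases "\<one> \<in> L")
      case True then show ?thesis using L ideal.one_imp_carrier by blast
    next
      case False then show ?thesis using I(2)[of L] L by (simp add: S_def)
    qed
  qed
  then show ?thesis by blast
qed

lemma maximal_not_subset:
  assumes "maximalideal P R" "maximalideal M R" "P \<noteq> M"
  shows "\<exists>x\<in>P. x \<notin> M"
proof (rule ccontr)
  assume "\<not> (\<exists>x\<in>P. x \<notin> M)"
  then have "P \<subseteq> M" by blast
  moreover have "M \<subseteq> carrier R" using maximal_sub[OF assms(2)] by blast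
  ultimately show False
    using maximalideal.I_maximal[OF assms(1) maximal_ideal[OF assms(2)]] assms(3)
      maximalideal.I_notcarr[OF assms(2)] by blast
qed

text \<open>A product of elements, one from each other maximal ideal and all outside
  \<open>M\<close>, stays outside the prime ideal \<open>M\<close>. Its idempotent power is then
  \<open>1\<close> modulo \<open>M\<close> and still lies in the other ideals.\<close>

lemma separating_idempotent:
  assumes M: "maximalideal M R"
  shows "\<exists>e\<in>carrier R. \<one> \<ominus> e \<in> M \<and> (\<forall>P. maximalideal P R \<and> P \<noteq> M \<longrightarrow> e \<in> P)"
proof -
  define S where "S = {P. maximalideal P R \<and> P \<noteq> M}"
  have "S \<subseteq> Pow (carrier R)" using maximal_sub by (auto simp: S_def)
  then have fS: "finite S" using fin finite_subset by blast
  have "\<exists>y\<in>carrier R. y \<notin> M \<and> (\<forall>P\<in>T. y \<in> P)" if "finite T" "T \<subseteq> S" for T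
    using that
  proof (induction T)
    case empty
    then show ?case using maximal_one[OF M] by (intro bexI[of _ \<one>]) auto
  next
    case (insert P T)
    then obtain y where y: "y \<in> carrier R" "y \<notin> M" "\<forall>P\<in>T. y \<in> P" by auto
    obtain x where x: "x \<in> P" "x \<notin> M"
      using maximal_not_subset[OF _ M] insert.prems by (auto simp: S_def)
    have xc: "x \<in> carrier R" using x insert.prems maximal_sub by (auto simp: S_def)
    have "x \<otimes> y \<notin> M" using maximal_prime[OF M xc y(1)] x y by simp
    moreover have "\<forall>Q\<in>insert P T. x \<otimes> y \<in> Q"
      using maximal_prime[OF _ xc y(1)] x y insert.prems by (auto simp: S_def)
    ultimately show ?case using xc y by (intro bexI[of _ "x \<otimes> y"]) auto
  qed
  from this[OF fS subset_refl] obtain y where y: "y \<in> carrier R" "y \<notin> M" "\<forall>P\<in>S. y \<in> P" by blast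
  have "y [^] expo \<in> P" if "maximalideal P R" "P \<noteq> M" for P
  proof -
    have "expo = Suc (expo - 1)" using expo_ge_2 by simp
    then have "y [^] expo = y [^] (expo - 1) \<otimes> y" by (metis nat_pow_Suc)
    moreover have "y \<in> P" using y(3) that by (simp add: S_def)
    ultimately show ?thesis using maximal_prime[OF that(1)] y(1) by simp
  qed
  moreover have "\<one> \<ominus> y [^] expo \<in> M"
    using maximal_idem[OF M _ pow_expo_idem[OF y(1)]] maximal_pow[OF M y(1,2)] y(1) by simp
  ultimately show ?thesis using y(1) by (intro bexI[of _ "y [^] expo"]) auto
qed

end

section \<open>Coordinates on the ring\<close>

lemma pancyclic_on_image:
  assumes pan: "pancyclic_on A V" and f: "inj_on f V" "f ` V = W"
    and adj: "\<And>p q. p \<in> V \<Longrightarrow> q \<in> V \<Longrightarrow> A p q \<Longrightarrow> E (f p) (f q)"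
  shows "pancyclic_on E W"
  unfolding pancyclic_on_def
proof (intro allI impI, elim conjE)
  fix l assume l: "3 \<le> l" "l \<le> card W"
  have "card W = card V" using f card_image by blast
  then obtain xs where xs: "cycle_list A xs" "set xs \<subseteq> V" "length xs = l"
    using pan l unfolding pancyclic_on_def by auto
  have ne: "xs \<noteq> []" using xs(3) l(1) by auto
  have "successively (\<lambda>x y. E (f x) (f y)) xs"
  proof (rule successively_mono)
    show "successively A xs" using xs(1) by (simp add: cycle_list_def)
  qed (use xs(2) adj in blast)
  moreover have "E (f (last xs)) (f (hd xs))"
    using xs(1,2) adj[of "last xs" "hd xs"] last_in_set[OF ne] hd_in_set[OF ne]
    by (auto simp: cycle_list_def simp del: last_in_set hd_in_set)
  moreover have "distinct (map f xs)"
    using xs(1,2) f(1) inj_on_subset by (auto simp: distinct_map cycle_list_def)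
  ultimately have "cycle_list E (map f xs)"
    using xs(1) ne by (simp add: cycle_list_def successively_map last_map hd_map)
  then show "\<exists>xs. cycle_list E xs \<and> set xs \<subseteq> W \<and> length xs = l"
    using xs f(2) by (intro exI[of _ "map f xs"]) auto
qed

context finite_cring
begin

lemma jacobson_iff:
  "x \<in> jacobson_radical R \<longleftrightarrow> x \<in> carrier R \<and> (\<forall>P. maximalideal P R \<longrightarrow> x \<in> P)"
  by (simp add: jacobson_radical_def)

lemma jacobson_graph_arc:
  assumes "maximalideal P R" "\<one> \<ominus> x \<otimes> y \<in> P" "x \<noteq> y"
    "x \<in> carrier R - jacobson_radical R" "y \<in> carrier R - jacobson_radical R"
  shows "(x, y) \<in> parcs (jacobson_graph R)"
  using assms maximal_not_unit by (simp add: jacobson_graph_def)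

end

section \<open>The bijection between coordinates and ring elements\<close>

locale finite_cring_at = finite_cring +
  fixes M
  assumes M: "maximalideal M R" and two: "2 \<le> card (M - jacobson_radical R)"
begin

abbreviation "F \<equiv> R Quot M"
abbreviation "Jac \<equiv> jacobson_radical R"

definition H :: "'a \<Rightarrow> 'a \<Rightarrow> bool" where
  "H v w \<longleftrightarrow> v \<in> carrier R \<and> w \<in> carrier R
    \<and> (\<exists>P. maximalideal P R \<and> P \<noteq> M \<and> \<one> \<ominus> v \<otimes> w \<in> P)"

lemma carrier_F: "carrier F = (+>) M ` carrier R"
  by (auto simp: FactRing_def A_RCOSETS_def')

sublocale quot: ring_hom_cring R F "(+>) M"
  using ideal.rcos_ring_hom_cring[OF maximal_ideal[OF M] is_cring] .

sublocale quot_field: field F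
  using maximalideal.quotient_is_field[OF M is_cring] .

lemma coset_eq_iff:
  "x \<in> carrier R \<Longrightarrow> y \<in> carrier R \<Longrightarrow> M +> x = M +> y \<longleftrightarrow> x \<ominus> y \<in> M"
  using quotient_eq_iff_same_a_r_cos[OF maximal_ideal[OF M]] by simp

lemma zero_F: "\<zero>\<^bsub>F\<^esub> = M +> \<zero>"
  using quot.hom_zero by simp

lemma one_F: "\<one>\<^bsub>F\<^esub> = M +> \<one>"
  using quot.hom_one by simp

lemma coset_zero_iff:
  assumes x: "x \<in> carrier R"
  shows "M +> x = \<zero>\<^bsub>F\<^esub> \<longleftrightarrow> x \<in> M"
proof -
  have "x \<ominus> \<zero> = x" using x by algebra
  then show ?thesis using coset_eq_iff[OF x zero_closed] zero_F by (simp only:)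
qed

lemma M_sub: "M \<subseteq> carrier R" "Jac \<subseteq> M"
  using maximal_sub[OF M] M by (auto simp: jacobson_iff)

lemma coords: "coords (carrier F) \<zero>\<^bsub>F\<^esub> \<one>\<^bsub>F\<^esub> (m_inv F) M Jac H ginv"
proof
  show "finite (carrier F)" "finite M"
    using fin M_sub finite_subset by (auto simp: carrier_F)
  show "\<zero>\<^bsub>F\<^esub> \<in> carrier F" "\<one>\<^bsub>F\<^esub> \<in> carrier F" by simp_all
  show "\<zero>\<^bsub>F\<^esub> \<noteq> \<one>\<^bsub>F\<^esub>" using quot_field.zero_not_one .
  show "m_inv F c \<in> carrier F \<and> m_inv F c \<noteq> \<zero>\<^bsub>F\<^esub> \<and> m_inv F (m_inv F c) = c"
    if "c \<in> carrier F" "c \<noteq> \<zero>\<^bsub>F\<^esub>" for c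
  proof -
    have c: "c \<in> Units F" using that quot_field.field_Units by simp
    then have "m_inv F c \<in> Units F" by (rule quot.S.Units_inv_Units)
    then show ?thesis using c quot_field.field_Units by auto
  qed
  show "m_inv F \<one>\<^bsub>F\<^esub> = \<one>\<^bsub>F\<^esub>" by simp
  show "Jac \<subseteq> M" by (fact M_sub)
  show "Jac \<noteq> {}" 
  proof -
    have "\<zero> \<in> Jac" using maximal_zero by (simp add: jacobson_iff)
    then show ?thesis by blast
  qed
  show "H w v" if "H v w" for v w using that by (auto simp: H_def m_comm)
  show "ginv v \<in> M - Jac \<and> ginv (ginv v) = v \<and> H v (ginv v)" if v: "v \<in> M - Jac" for v
  proof -
    have vc: "v \<in> carrier R" using v M_sub by blast
    then obtain P where P: "maximalideal P R" "v \<notin> P" using v by (auto simp: jacobson_iff)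
    have "H v (ginv v)"
      using ginv_maximal(1)[OF P(1) vc P(2)] P v vc by (auto simp: H_def)
    moreover have "ginv v \<in> M" using ginv_maximal(2)[OF M vc] v by simp
    moreover have "ginv v \<notin> Jac"
    proof
      assume "ginv v \<in> Jac"
      then have "ginv (ginv v) \<in> P"
        using ginv_maximal(2)[OF P(1), of "ginv v"] P(1) by (simp add: jacobson_iff)
      then show False using P(2) ginv_ginv[OF vc] by simp
    qed
    ultimately show ?thesis using ginv_ginv[OF vc] by simp
  qed
  show "2 \<le> card (M - Jac)" by (fact two)
qed

sublocale co: coords "carrier F" "\<zero>\<^bsub>F\<^esub>" "\<one>\<^bsub>F\<^esub>" "m_inv F" M Jac H ginv
  by (fact coords)

definition eps :: 'a where
  "eps = (SOME e. e \<in> carrier R \<and> \<one> \<ominus> e \<in> M \<and> (\<forall>P. maximalideal P R \<and> P \<noteq> M \<longrightarrow> e \<in> P))"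

lemma eps: "eps \<in> carrier R" "\<one> \<ominus> eps \<in> M" "maximalideal P R \<Longrightarrow> P \<noteq> M \<Longrightarrow> eps \<in> P"
proof -
  have "eps \<in> carrier R \<and> \<one> \<ominus> eps \<in> M \<and> (\<forall>P. maximalideal P R \<and> P \<noteq> M \<longrightarrow> eps \<in> P)"
    unfolding eps_def by (rule someI_ex) (use separating_idempotent[OF M] in blast)
  then show "eps \<in> carrier R" "\<one> \<ominus> eps \<in> M" "maximalideal P R \<Longrightarrow> P \<noteq> M \<Longrightarrow> eps \<in> P" by blast+
qed

definition rep :: "'a set \<Rightarrow> 'a" where
  "rep c = (SOME x. x \<in> carrier R \<and> M +> x = c)"

lemma rep:
  assumes "c \<in> carrier F"
  shows "rep c \<in> carrier R" "M +> rep c = c"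
proof -
  have "rep c \<in> carrier R \<and> M +> rep c = c"
    unfolding rep_def by (rule someI_ex) (use assms in \<open>auto simp: carrier_F\<close>)
  then show "rep c \<in> carrier R" "M +> rep c = c" by simp_all
qed

text \<open>This element is in the class \<open>fst p\<close> modulo \<open>M\<close> and congruent
  to \<open>snd p\<close> modulo every other maximal ideal. As \<open>rep\<close> is an arbitrary
  choice of representatives, \<open>pt\<close> serves as a bijection of sets and not as a
  homomorphism.\<close>

definition pt :: "'a set \<times> 'a \<Rightarrow> 'a" where
  "pt p = snd p \<oplus> rep (fst p) \<otimes> eps"

lemma pt_closed: "c \<in> carrier F \<Longrightarrow> v \<in> M \<Longrightarrow> pt (c, v) \<in> carrier R"
  using rep(1) eps(1) M_sub by (auto simp: pt_def)

lemma pt_coset: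
  assumes c: "c \<in> carrier F" and v: "v \<in> M"
  shows "M +> pt (c, v) = c"
proof -
  note r = rep[OF c]
  have vc: "v \<in> carrier R" using v M_sub by blast
  have "pt (c, v) \<ominus> rep c = v \<ominus> rep c \<otimes> (\<one> \<ominus> eps)"
    using r vc eps(1) unfolding pt_def fst_conv snd_conv by algebra
  moreover have "rep c \<otimes> (\<one> \<ominus> eps) \<in> M"
    using maximal_prime[OF M] r(1) eps(1,2) by simp
  ultimately have "pt (c, v) \<ominus> rep c \<in> M" using maximal_minus[OF M v] by simp
  then have "M +> pt (c, v) = M +> rep c"
    using coset_eq_iff pt_closed[OF c v] r(1) by blast
  then show ?thesis using r(2) by simp
qed

lemma pt_inj: "inj_on pt (carrier F \<times> M)"
proof (rule inj_onI, clarify)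
  fix c v d w assume *: "c \<in> carrier F" "v \<in> M" "d \<in> carrier F" "w \<in> M" "pt (c, v) = pt (d, w)"
  have cd: "c = d" using pt_coset[OF *(1,2)] pt_coset[OF *(3,4)] *(5) by simp
  have "v \<in> carrier R" "w \<in> carrier R" "rep c \<otimes> eps \<in> carrier R"
    using * M_sub rep(1) eps(1) by auto
  then have "v = w" using *(5) unfolding cd pt_def by (auto simp: cd)
  with cd show "c = d \<and> v = w" by simp
qed

lemma pt_surj: "x \<in> carrier R \<Longrightarrow> \<exists>p\<in>carrier F \<times> M. pt p = x"
proof -
  assume x: "x \<in> carrier R"
  define c where "c = M +> x"
  have c: "c \<in> carrier F" using x by (auto simp: carrier_F c_def)
  note r = rep[OF c]
  define v where "v = x \<ominus> rep c \<otimes> eps"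
  have "M +> x = M +> rep c" using r(2) by (simp add: c_def)
  then have "x \<ominus> rep c \<in> M" using coset_eq_iff x r(1) by simp
  moreover have "rep c \<otimes> (\<one> \<ominus> eps) \<in> M"
    using maximal_prime[OF M] r(1) eps(1,2) by simp
  moreover have "v = (x \<ominus> rep c) \<oplus> rep c \<otimes> (\<one> \<ominus> eps)"
    using x r(1) eps(1) unfolding v_def by algebra
  ultimately have "v \<in> M" using maximal_add[OF M] by simp
  moreover have "pt (c, v) = x" using x r(1) eps(1) unfolding v_def pt_def fst_conv snd_conv by algebra
  ultimately show ?thesis using c by (intro bexI[of _ "(c, v)"]) auto
qed

lemma pt_jacobson_iff:
  assumes c: "c \<in> carrier F" and v: "v \<in> M"
  shows "pt (c, v) \<in> Jac \<longleftrightarrow> c = \<zero>\<^bsub>F\<^esub> \<and> v \<in> Jac"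
proof -
  note r = rep[OF c]
  have cl: "v \<in> carrier R" "rep c \<otimes> eps \<in> carrier R" using v M_sub r(1) eps(1) by auto
  have *: "pt (c, v) \<in> Jac \<longleftrightarrow> v \<in> Jac" if "c = \<zero>\<^bsub>F\<^esub>"
  proof -
    \<comment> \<open>\<open>rep c\<close> lies in \<open>M\<close> and \<open>eps\<close> in all
      other maximal ideals, so their product lies in every one and does not affect
      membership.\<close>
    have "rep c \<in> M" using r that coset_zero_iff by simp
    then have re: "rep c \<otimes> eps \<in> P" if "maximalideal P R" for P
      using maximal_prime[OF that r(1) eps(1)] eps(3)[OF that] by blast
    have "pt (c, v) \<in> P \<longleftrightarrow> v \<in> P" if P: "maximalideal P R" for P
    proof
      assume "pt (c, v) \<in> P"
      then have "pt (c, v) \<ominus> rep c \<otimes> eps \<in> P" using maximal_minus[OF P] re[OF P] by blast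
      moreover have "pt (c, v) \<ominus> rep c \<otimes> eps = v"
        using cl(1) r(1) eps(1) unfolding pt_def fst_conv snd_conv by algebra
      ultimately show "v \<in> P" by simp
    next
      assume "v \<in> P"
      then show "pt (c, v) \<in> P" using maximal_add[OF P] re[OF P] by (simp add: pt_def)
    qed
    then show ?thesis using pt_closed[OF c v] cl(1) by (simp add: jacobson_iff)
  qed
  have "c = \<zero>\<^bsub>F\<^esub>" if "pt (c, v) \<in> Jac"
  proof -
    have "pt (c, v) \<in> M" using that M_sub by blast
    then show ?thesis using pt_coset[OF c v] coset_zero_iff[OF pt_closed[OF c v]] by simp
  qed
  then show ?thesis using * by blast
qed

lemma pt_image: "pt ` co.V = carrier R - Jac"
proof
  show "pt ` co.V \<subseteq> carrier R - Jac"
    using pt_closed pt_jacobson_iff by (auto simp: co.V_def)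
  show "carrier R - Jac \<subseteq> pt ` co.V"
  proof
    fix x assume x: "x \<in> carrier R - Jac"
    then obtain c v where "c \<in> carrier F" "v \<in> M" "pt (c, v) = x" using pt_surj by force
    moreover from this have "\<not> (c = \<zero>\<^bsub>F\<^esub> \<and> v \<in> Jac)" using pt_jacobson_iff x by blast
    ultimately show "x \<in> pt ` co.V" by (force simp: co.V_def)
  qed
qed

lemma pt_arc:
  assumes pq: "p \<in> co.V" "q \<in> co.V" and adj: "co.adj p q"
  shows "(pt p, pt q) \<in> parcs (jacobson_graph R)"
proof -
  obtain c v d w where p: "p = (c, v)" and q: "q = (d, w)" by (metis surj_pair)
  have in_F: "c \<in> carrier F" "d \<in> carrier F" and in_M: "v \<in> M" "w \<in> M"
    using pq by (auto simp: co.V_def p q)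
  have cl: "pt p \<in> carrier R" "pt q \<in> carrier R" using pt_closed in_F in_M by (simp_all add: p q)
  have ne: "pt p \<noteq> pt q"
  proof
    assume "pt p = pt q"
    then have "p = q" by (rule inj_onD[OF pt_inj]) (use in_F in_M in \<open>simp_all add: p q\<close>)
    then show False using adj by (simp add: co.adj_def)
  qed
  have vert: "pt p \<in> carrier R - Jac" "pt q \<in> carrier R - Jac" using pt_image pq by auto
  have "\<exists>P. maximalideal P R \<and> \<one> \<ominus> pt p \<otimes> pt q \<in> P"
  proof (cases "c \<noteq> \<zero>\<^bsub>F\<^esub> \<and> d = m_inv F c")
    case True
    then have "c \<in> Units F" using in_F quot_field.field_Units by simp
    then have "c \<otimes>\<^bsub>F\<^esub> d = \<one>\<^bsub>F\<^esub>" using True quot.S.Units_r_inv by simp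
    moreover have "M +> (pt p \<otimes> pt q) = c \<otimes>\<^bsub>F\<^esub> d"
      using cl pt_coset in_F in_M by (simp add: p q)
    ultimately have "M +> (pt p \<otimes> pt q) = M +> \<one>" using one_F by metis
    then have "\<one> \<ominus> pt p \<otimes> pt q \<in> M" using coset_eq_iff[of \<one> "pt p \<otimes> pt q"] cl by simp
    then show ?thesis using M by blast
  next
    case False
    then have "H v w" using adj by (auto simp: co.adj_def p q)
    then obtain P where P: "maximalideal P R" "P \<noteq> M" "\<one> \<ominus> v \<otimes> w \<in> P"
      by (auto simp: H_def)
    have r: "rep c \<in> carrier R" "rep d \<in> carrier R" "v \<in> carrier R" "w \<in> carrier R"
      using rep(1) in_F in_M M_sub by auto
    \<comment> \<open>All terms other than \<open>\<one> \<ominus> v \<otimes> w\<close> are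
      multiples of \<open>eps\<close>, which belongs to \<open>P\<close>.\<close>
    have "\<one> \<ominus> pt p \<otimes> pt q
      = (\<one> \<ominus> v \<otimes> w) \<ominus> eps \<otimes> (rep c \<otimes> w \<oplus> v \<otimes> rep d \<oplus> rep c \<otimes> rep d \<otimes> eps)"
      using r eps(1) unfolding p q pt_def fst_conv snd_conv by algebra
    moreover have "eps \<otimes> (rep c \<otimes> w \<oplus> v \<otimes> rep d \<oplus> rep c \<otimes> rep d \<otimes> eps) \<in> P"
      using maximal_prime[OF P(1) eps(1)] eps(3)[OF P(1,2)] r eps(1) by simp
    ultimately show ?thesis using maximal_minus[OF P(1,3)] P(1) by auto
  qed
  then show ?thesis using jacobson_graph_arc ne vert by blast
qed

lemma pancyclic_transfer:
  assumes "pancyclic_on co.adj co.V"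
  shows "pancyclic_on (\<lambda>x y. (x, y) \<in> parcs (jacobson_graph R)) (carrier R - Jac)"
proof (rule pancyclic_on_image)
  show "pancyclic_on co.adj co.V" by (fact assms)
  show "inj_on pt co.V" using pt_inj by (rule inj_on_subset) (auto simp: co.V_def)
  show "pt ` co.V = carrier R - Jac" by (fact pt_image)
qed (fact pt_arc)

end

lemma even_card_involution:
  assumes "finite A" "\<And>x. x \<in> A \<Longrightarrow> f x \<in> A" "\<And>x. x \<in> A \<Longrightarrow> f (f x) = x"
    "\<And>x. x \<in> A \<Longrightarrow> f x \<noteq> x"
  shows "even (card A)"
  using assms
proof (induction "card A" arbitrary: A rule: less_induct)
  case less
  show ?case
  proof (cases "A = {}")
    case False
    then obtain a where a: "a \<in> A" by blast
    have fa: "f a \<in> A" "f a \<noteq> a" using a less.prems by auto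
    have c: "card A = Suc (Suc (card (A - {a} - {f a})))"
    proof -
      have "card A = Suc (card (A - {a}))" by (rule card.remove[OF less.prems(1) a])
      also have "card (A - {a}) = Suc (card (A - {a} - {f a}))"
        by (rule card.remove) (use fa less.prems(1) in simp_all)
      finally show ?thesis .
    qed
    have "even (card (A - {a} - {f a}))"
    proof (rule less.hyps)
      show "f x \<in> A - {a} - {f a}" if "x \<in> A - {a} - {f a}" for x
        using that less.prems(2,3)[of x] less.prems(3)[OF a] by auto
    qed (use c less.prems in auto)
    then show ?thesis using c by simp
  qed simp
qed

section \<open>What a Hamiltonian cycle forces, and the easy direction\<close>

context finite_cring
begin

abbreviation edge :: "'a \<Rightarrow> 'a \<Rightarrow> bool" where
  "edge \<equiv> \<lambda>x y. (x, y) \<in> parcs (jacobson_graph R)"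

lemma two_ideals:
  assumes "\<not> local_ring R" "maximalideal M R"
  shows "\<exists>P. maximalideal P R \<and> P \<noteq> M"
  using assms is_cring by (auto simp: local_ring_def)

lemma vertices: "pverts (jacobson_graph R) = carrier R - jacobson_radical R"
  by (simp add: jacobson_graph_def)

text \<open>Pancyclicity speaks only of lengths from \<open>3\<close> on; this bound makes the
  number of vertices one of them. The three vertices come from splitting \<open>\<one>\<close> by an
  element that separates two maximal ideals.\<close>

lemma card_vertices_ge_3:
  assumes nl: "\<not> local_ring R"
  shows "3 \<le> card (carrier R - jacobson_radical R)"
proof -
  obtain M where M: "maximalideal M R" using ex_maximal by blast
  obtain P where P: "maximalideal P R" "P \<noteq> M" using two_ideals[OF nl M] by blast
  obtain e where e: "e \<in> carrier R" "\<one> \<ominus> e \<in> M" "e \<in> P"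
    using separating_idempotent[OF M] P by blast
  have one: "(\<one> \<ominus> e) \<oplus> e = \<one>" using e(1) by algebra
  have "e \<notin> M" using maximal_add[OF M e(2), of e] maximal_one[OF M] one by auto
  moreover have "\<one> \<ominus> e \<notin> P" using maximal_add[OF P(1) _ e(3), of "\<one> \<ominus> e"] maximal_one[OF P(1)] one by auto
  ultimately have "{\<one>, e, \<one> \<ominus> e} \<subseteq> carrier R - jacobson_radical R"
    and "e \<noteq> \<one>" "\<one> \<ominus> e \<noteq> \<one>" "e \<noteq> \<one> \<ominus> e"
    using e M P maximal_one by (auto simp: jacobson_iff)
  then show ?thesis
    using card_mono[of "carrier R - jacobson_radical R" "{\<one>, e, \<one> \<ominus> e}"] fin by auto
qed

text \<open>
  If \<open>M - J\<close> is a singleton \<open>{v}\<close>, then \<open>R\<close> is the product of the field with two elements and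
  another field, and \<open>\<one> \<ominus> v\<close>, which generates the second factor, has \<open>\<one>\<close> as its only neighbour.
\<close>

lemma two_le_card_of_hamiltonian:
  assumes nl: "\<not> local_ring R" and ham: "hamiltonian (jacobson_graph R)" and M: "maximalideal M R"
  shows "2 \<le> card (M - jacobson_radical R)"
proof (rule ccontr)
  assume "\<not> 2 \<le> card (M - jacobson_radical R)"
  then have c1: "card (M - jacobson_radical R) \<le> Suc 0" by simp
  have Msub: "M \<subseteq> carrier R" using maximal_sub[OF M] by blast
  have Jsub: "jacobson_radical R \<subseteq> M" using M by (auto simp: jacobson_iff)
  have fM: "finite (M - jacobson_radical R)" using fin Msub finite_subset by blast
  obtain P where P: "maximalideal P R" "P \<noteq> M" using two_ideals[OF nl M] by blast
  obtain v where v: "v \<in> M" "v \<notin> P" using maximal_not_subset[OF M P(1)] P(2) by metis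
  have vc: "v \<in> carrier R" using v Msub by blast
  have uniq: "w = v" if "w \<in> M" "w \<notin> jacobson_radical R" for w
  proof -
    have "v \<notin> jacobson_radical R" using v P(1) by (auto simp: jacobson_iff)
    then show ?thesis using c1[unfolded card_le_Suc0_iff_eq[OF fM]] that v(1) by blast
  qed
  \<comment> \<open>\<open>v \<oplus> z\<close> again lies in \<open>M\<close> but not in
    \<open>P\<close>, so uniqueness forces it to be \<open>v\<close>.\<close>
  have J0: "z = \<zero>" if z: "z \<in> jacobson_radical R" for z
  proof -
    have zc: "z \<in> carrier R" "z \<in> M" "z \<in> P" using z M P(1) by (simp_all add: jacobson_iff)
    have "(v \<oplus> z) \<ominus> z = v" using vc zc by algebra
    then have "v \<oplus> z \<notin> P" using maximal_minus[OF P(1) _ zc(3), of "v \<oplus> z"] v(2) by auto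
    then have "v \<oplus> z \<notin> jacobson_radical R" using P(1) jacobson_iff by blast
    then have "v \<oplus> z = v" using uniq[OF maximal_add[OF M v(1) zc(2)]] by simp
    moreover have "z = (v \<oplus> z) \<ominus> v" using vc zc by algebra
    ultimately show ?thesis using vc by (simp add: r_right_minus_eq)
  qed
  have M01: "w = \<zero> \<or> w = v" if "w \<in> M" for w using uniq[OF that] J0[of w] by blast
  have vv: "v \<otimes> v = v"
  proof -
    have "v \<otimes> v \<in> M" using maximal_prime[OF M vc vc] v by simp
    moreover have "v \<otimes> v \<noteq> \<zero>" using maximal_prime[OF P(1) vc vc] maximal_zero[OF P(1)] v by auto
    ultimately show ?thesis using M01 by blast
  qed
  define e where "e = \<one> \<ominus> v"
  have ec: "e \<in> carrier R" using vc by (simp add: e_def)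
  have ev: "e \<otimes> v = \<zero>"
  proof -
    have "e \<otimes> v = v \<ominus> v \<otimes> v" unfolding e_def using vc by algebra
    then show ?thesis using vv vc by (simp add: r_right_minus_eq)
  qed
  have eM: "e \<otimes> w = \<zero>" if "w \<in> M" for w using M01[OF that] ev ec by auto
  have ee: "e \<otimes> e = e"
  proof -
    have "e \<otimes> e = e \<ominus> e \<otimes> v" unfolding e_def using vc by algebra
    also have "\<dots> = e" unfolding ev using ec by algebra
    finally show ?thesis .
  qed
  have "e \<oplus> v = \<one>" unfolding e_def using vc by algebra
  then have "e \<notin> M" using maximal_add[OF M _ v(1), of e] maximal_one[OF M] by auto
  then have eV: "e \<in> carrier R - jacobson_radical R" using ec Jsub by blast
  have only: "x = \<one>" if x: "x \<in> carrier R" "x \<noteq> e" "\<one> \<ominus> e \<otimes> x \<notin> Units R" for x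
  proof -
    \<comment> \<open>\<open>a\<close> is the component of \<open>\<one> \<ominus> x\<close> in the
      second factor, and \<open>\<one> \<ominus> e \<otimes> x = v \<oplus> a\<close>. If
      \<open>a\<close> were outside \<open>M\<close>, it would be invertible in that factor, making
      this sum a unit.\<close>
    define a where "a = e \<otimes> (\<one> \<ominus> x)"
    have ac: "a \<in> carrier R" using ec x by (simp add: a_def)
    have ea: "e \<otimes> a = a" using ee ec x by (simp add: a_def m_assoc[symmetric])
    have "a \<in> M"
    proof (rule ccontr)
      assume "a \<notin> M"
      then have b: "\<one> \<ominus> a \<otimes> ginv a \<in> M" by (rule ginv_maximal(1)[OF M ac])
      define y where "y = ginv a"
      have yc: "y \<in> carrier R" using ac by (simp add: y_def)
      have "e \<otimes> (\<one> \<ominus> a \<otimes> y) = \<zero>" using b eM by (simp add: y_def)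
      moreover have "e \<otimes> (\<one> \<ominus> a \<otimes> y) = e \<ominus> (e \<otimes> a) \<otimes> y" using ec ac yc by algebra
      ultimately have ay: "e = a \<otimes> y" using ea ec ac yc by (simp add: r_right_minus_eq)
      have va: "v \<otimes> a = \<zero>" using eM[OF v(1)] vc ec x unfolding a_def
        by (simp add: m_assoc[symmetric] m_comm[of v e])
      \<comment> \<open>The inverse is taken in each factor separately: \<open>v\<close> is its own
        inverse, \<open>a \<otimes> y = e\<close>, and the mixed products vanish.\<close>
      have "(v \<oplus> a) \<otimes> (v \<oplus> e \<otimes> y) = v \<otimes> v \<oplus> (e \<otimes> v) \<otimes> y \<oplus> v \<otimes> a \<oplus> (e \<otimes> a) \<otimes> y"
        using vc ac ec yc by algebra
      also have "\<dots> = v \<oplus> e" using vv ev va ea ay vc ac yc by simp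
      also have "\<dots> = \<one>" unfolding e_def using vc by algebra
      finally have "(v \<oplus> a) \<otimes> (v \<oplus> e \<otimes> y) = \<one>" .
      moreover have "v \<oplus> a \<in> carrier R" "v \<oplus> e \<otimes> y \<in> carrier R" using vc ac ec yc by simp_all
      ultimately have "v \<oplus> a \<in> Units R" unfolding Units_def using m_comm by fastforce
      moreover have "\<one> \<ominus> e \<otimes> x = v \<oplus> a" unfolding a_def e_def using vc x(1) by algebra
      ultimately show False using x(3) by simp
    qed
    then have "e \<otimes> a = \<zero>" using eM by simp
    then have a0: "a = \<zero>" using ea by simp
    \<comment> \<open>With \<open>a = \<zero>\<close>, the element \<open>\<one> \<ominus> x\<close>
      lies in \<open>M = {\<zero>, v}\<close>, and the value \<open>v\<close> would mean
      \<open>x = e\<close>.\<close>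
    have "\<one> \<ominus> x = a \<oplus> v \<otimes> (\<one> \<ominus> x)" unfolding a_def e_def using vc x by algebra
    then have "\<one> \<ominus> x = v \<otimes> (\<one> \<ominus> x)" using a0 vc x by simp
    then have "\<one> \<ominus> x \<in> M" using maximal_prime[OF M vc, of "\<one> \<ominus> x"] v(1) x by simp
    moreover have "\<one> \<ominus> x \<noteq> v"
    proof
      assume "\<one> \<ominus> x = v"
      then have "e = \<one> \<ominus> (\<one> \<ominus> x)" by (simp add: e_def)
      also have "\<dots> = x" using x by algebra
      finally show False using x by simp
    qed
    ultimately have "\<one> \<ominus> x = \<zero>" using M01 by blast
    then show "x = \<one>" using x by (simp add: r_right_minus_eq)
  qed
  obtain p where p: "graph_cycle (jacobson_graph R) p" "fst ` set p = pverts (jacobson_graph R)"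
    using ham by (auto simp: hamiltonian_def)
  then have "e \<in> fst ` set p" using eV by (simp add: vertices)
  from graph_cycle_two_neighbours[OF p(1) this] obtain u w
    where uw: "u \<noteq> w" "edge u e" "edge e w" by blast
  have "u = \<one>" using only[of u] uw(2) ec by (auto simp: jacobson_graph_def m_comm)
  moreover have "w = \<one>" using only[of w] uw(3) ec by (auto simp: jacobson_graph_def)
  ultimately show False using uw(1) by simp
qed

lemma pancyclic_of_pancyclic_on:
  assumes "pancyclic_on edge (carrier R - jacobson_radical R)"
  shows "pancyclic (jacobson_graph R)"
  unfolding pancyclic_def
proof (intro allI impI, elim conjE)
  fix l assume "3 \<le> l" "l \<le> card (pverts (jacobson_graph R))"
  then obtain xs where xs: "cycle_list edge xs" "set xs \<subseteq> carrier R - jacobson_radical R" "length xs = l"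
    using assms by (auto simp: pancyclic_on_def vertices)
  then show "\<exists>p. graph_cycle (jacobson_graph R) p \<and> length p = l"
    using graph_cycle_of_cycle_list[OF xs(1)] by (simp add: vertices)
qed

lemma hamiltonian_of_pancyclic:
  assumes nl: "\<not> local_ring R" and pan: "pancyclic (jacobson_graph R)"
  shows "hamiltonian (jacobson_graph R)"
proof -
  let ?V = "carrier R - jacobson_radical R"
  obtain p where p: "graph_cycle (jacobson_graph R) p" "length p = card ?V"
    using pan card_vertices_ge_3[OF nl] by (auto simp: pancyclic_def vertices)
  have sub: "fst ` set p \<subseteq> ?V"
    using graph_cycleD(1)[OF p(1)] by (auto simp: jacobson_graph_def)
  have "card (fst ` set p) = card ?V"
    using graph_cycleD(2)[OF p(1)] p(2) distinct_card[of "map fst p"] by simp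
  then have "fst ` set p = ?V" using sub fin by (metis card_subset_eq finite_Diff)
  then show ?thesis using p(1) by (auto simp: hamiltonian_def vertices)
qed

end

section \<open>The three kinds of residue fields\<close>

context finite_cring_at
begin

lemma sub_in: "w \<in> M \<Longrightarrow> w \<in> carrier R" "w \<in> Jac \<Longrightarrow> w \<in> M" "w \<in> Jac \<Longrightarrow> w \<in> carrier R"
  using M_sub by blast+

lemma unit_coset: "c \<in> co.units \<longleftrightarrow> (\<exists>x\<in>carrier R. x \<notin> M \<and> \<one> \<ominus> x \<notin> M \<and> c = M +> x)"
proof -
  have "M +> x \<in> co.units \<longleftrightarrow> x \<notin> M \<and> \<one> \<ominus> x \<notin> M" if "x \<in> carrier R" for x
  proof -
    have "M +> x = \<one>\<^bsub>F\<^esub> \<longleftrightarrow> \<one> \<ominus> x \<in> M" using coset_eq_iff[OF one_closed that] one_F by metis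
    then show ?thesis
      using coset_zero_iff[OF that] quot.hom_closed[OF that]
      by (simp only: co.units_def Diff_iff insert_iff empty_iff) blast
  qed
  moreover have "c \<in> (+>) M ` carrier R" if "c \<in> co.units"
    using that carrier_F unfolding co.units_def by blast
  ultimately show ?thesis by blast
qed

lemma minus_one_iff: "\<ominus>\<^bsub>F\<^esub> \<one>\<^bsub>F\<^esub> = \<one>\<^bsub>F\<^esub> \<longleftrightarrow> \<one> \<oplus> \<one> \<in> M"
proof -
  have "\<ominus>\<^bsub>F\<^esub> \<one>\<^bsub>F\<^esub> = M +> (\<ominus> \<one>)" by simp
  moreover have "\<one> \<ominus> (\<ominus> \<one>) = \<one> \<oplus> \<one>" by algebra
  ultimately show ?thesis using coset_eq_iff[OF one_closed a_inv_closed[OF one_closed]] one_F by metis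
qed

lemma involution: "c \<in> co.units \<Longrightarrow> m_inv F c = c \<Longrightarrow> c = \<ominus>\<^bsub>F\<^esub> \<one>\<^bsub>F\<^esub>"
proof -
  assume c: "c \<in> co.units" "m_inv F c = c"
  then have "c \<in> Units F" using quot_field.field_Units co.units[OF c(1)] by simp
  then have "c = \<one>\<^bsub>F\<^esub> \<or> c = \<ominus>\<^bsub>F\<^esub> \<one>\<^bsub>F\<^esub>" using c quot_field.inv_eq_self by simp
  then show ?thesis using co.units[OF c(1)] by metis
qed

text \<open>A self-inverse class is \<open>1\<close> or \<open>-1\<close>. These coincide here, and
  \<open>co.units\<close> excludes \<open>1\<close>.\<close>

lemma pancyclic_even_characteristic:
  assumes "\<one> \<oplus> \<one> \<in> M" "x \<in> carrier R" "x \<notin> M" "\<one> \<ominus> x \<notin> M"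
  shows "pancyclic_on edge (carrier R - Jac)"
proof (rule pancyclic_transfer, rule co.pancyclic_no_involution)
  show "co.units \<noteq> {}" using unit_coset assms(2-4) by blast
  show "m_inv F c \<noteq> c" if "c \<in> co.units" for c
    using involution[OF that] minus_one_iff assms(1) co.units[OF that] by metis
qed

text \<open>If the residue field of \<open>P\<close> has two elements, everything outside
  \<open>P\<close> is \<open>1\<close> modulo \<open>P\<close>, so this joins any two vertices
  outside \<open>P\<close>.\<close>

lemma residue_two:
  assumes "v \<in> carrier R" "w \<in> carrier R" "maximalideal P R" "\<one> \<ominus> v \<in> P" "\<one> \<ominus> w \<in> P"
  shows "\<one> \<ominus> v \<otimes> w \<in> P"
proof -
  have "\<one> \<ominus> v \<otimes> w = (\<one> \<ominus> v) \<oplus> v \<otimes> (\<one> \<ominus> w)" using assms(1,2) by algebra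
  moreover have "v \<otimes> (\<one> \<ominus> w) \<in> P" using maximal_prime[OF assms(3,1)] assms(2,5) by simp
  ultimately show ?thesis using maximal_add[OF assms(3,4)] by simp
qed

text \<open>The self-inverse class is \<open>-1\<close>. By \<open>res\<close>, another residue
  field of even characteristic has two elements and so joins all of \<open>M - P\<close>, which
  gives the additional \<open>H\<close>-edge; without such a field \<open>M - Jac\<close> has even
  size.\<close>

lemma pancyclic_odd_characteristic:
  assumes odd: "\<one> \<oplus> \<one> \<notin> M"
    and res: "\<And>P x. maximalideal P R \<Longrightarrow> \<one> \<oplus> \<one> \<in> P \<Longrightarrow> x \<in> carrier R \<Longrightarrow> x \<notin> P \<Longrightarrow> \<one> \<ominus> x \<in> P"
  shows "pancyclic_on edge (carrier R - Jac)"
proof (rule pancyclic_transfer, rule co.pancyclic_involution)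
  have n1: "\<ominus>\<^bsub>F\<^esub> \<one>\<^bsub>F\<^esub> \<noteq> \<one>\<^bsub>F\<^esub>" using odd minus_one_iff by blast
  have n0: "\<ominus>\<^bsub>F\<^esub> \<one>\<^bsub>F\<^esub> \<noteq> \<zero>\<^bsub>F\<^esub>"
    using quot.S.minus_minus[OF quot.S.one_closed] quot_field.zero_not_one quot.S.minus_zero by metis
  show "\<ominus>\<^bsub>F\<^esub> \<one>\<^bsub>F\<^esub> \<in> co.units" using n0 n1 by (simp add: co.units_def)
  show "m_inv F (\<ominus>\<^bsub>F\<^esub> \<one>\<^bsub>F\<^esub>) = \<ominus>\<^bsub>F\<^esub> \<one>\<^bsub>F\<^esub>"
    by (rule quot.S.comm_inv_char) (simp_all add: quot.S.l_minus quot.S.r_minus)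
  show "m_inv F c \<noteq> c" if "c \<in> co.units" "c \<noteq> \<ominus>\<^bsub>F\<^esub> \<one>\<^bsub>F\<^esub>" for c
    using that involution by blast
  have fM: "finite (M - Jac)" using fin M_sub finite_subset by blast
  show "even (card (M - Jac)) \<or> (\<exists>v\<in>M - Jac. \<exists>x\<in>M - Jac. x \<noteq> ginv v \<and> H x v)"
  proof (cases "\<exists>P. maximalideal P R \<and> P \<noteq> M \<and> \<one> \<oplus> \<one> \<in> P")
    case True
    then obtain P where P: "maximalideal P R" "P \<noteq> M" "\<one> \<oplus> \<one> \<in> P" by blast
    obtain v where v: "v \<in> M" "v \<notin> P" using maximal_not_subset[OF M P(1)] P(2) by metis
    have inMJ: "x \<in> M - Jac" if "x \<in> M" "x \<notin> P" for x using that P(1) by (auto simp: jacobson_iff)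
    have HP: "H x y" if "x \<in> M" "x \<notin> P" "y \<in> M" "y \<notin> P" for x y
      using that P residue_two[OF _ _ P(1)] res[OF P(1,3)] sub_in by (auto simp: H_def)
    \<comment> \<open>Were \<open>v\<close> alone in \<open>M - P\<close>, translating it by
      elements of \<open>M \<inter> P\<close> would force that intersection to be zero and leave
      \<open>M - Jac\<close> with a single element.\<close>
    have "\<exists>x. x \<in> M \<and> x \<notin> P \<and> x \<noteq> v"
    proof (rule ccontr)
      assume "\<not> (\<exists>x. x \<in> M \<and> x \<notin> P \<and> x \<noteq> v)"
      then have uniq: "x = v" if "x \<in> M" "x \<notin> P" for x using that by blast
      have vc: "v \<in> carrier R" using v sub_in by blast
      have zero: "z = \<zero>" if z: "z \<in> M" "z \<in> P" for z
      proof -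
        have zc: "z \<in> carrier R" using z sub_in by blast
        have "(v \<oplus> z) \<ominus> z = v" using vc zc by algebra
        then have "v \<oplus> z \<notin> P" using maximal_minus[OF P(1) _ z(2), of "v \<oplus> z"] v(2) by auto
        then have "v \<oplus> z = v" using uniq maximal_add[OF M v(1) z(1)] by blast
        moreover have "z = (v \<oplus> z) \<ominus> v" using vc zc by algebra
        ultimately show ?thesis using vc by (simp add: r_right_minus_eq)
      qed
      have "\<zero> \<in> Jac" using maximal_zero by (simp add: jacobson_iff)
      then have "M - Jac \<subseteq> {v}" using zero uniq by blast
      then have "card (M - Jac) \<le> 1" using card_mono[of "{v}" "M - Jac"] by simp
      then show False using two by simp
    qed
    then obtain x where x: "x \<in> M" "x \<notin> P" "x \<noteq> v" by blast
    have gv: "ginv v \<in> M - Jac" "ginv (ginv v) = v" "ginv v \<notin> P"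
    proof -
      show g: "ginv v \<in> M - Jac" "ginv (ginv v) = v" using co.bar inMJ[OF v] by auto
      show "ginv v \<notin> P" using ginv_maximal(2)[OF P(1), of "ginv v"] g v sub_in by auto
    qed
    show ?thesis
    proof (intro disjI2 bexI conjI)
      \<comment> \<open>\<open>ginv v\<close> takes the place of \<open>v\<close> in the goal, so
        that the inequality to prove becomes \<open>x \<noteq> v\<close>.\<close>
      show "x \<noteq> ginv (ginv v)" using gv x by simp
      show "H x (ginv v)" using HP x gv by blast
    qed (use gv inMJ x in auto)
  next
    case False
    \<comment> \<open>Negation pairs up the elements: \<open>v = \<ominus> v\<close> would put
      \<open>\<one> \<oplus> \<one>\<close> into any maximal ideal that misses \<open>v\<close>, and
      such an ideal differs from \<open>M\<close>.\<close>
    have "even (card (M - Jac))"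
    proof (rule even_card_involution[OF fM, of "\<lambda>v. \<ominus> v"])
      fix v assume v: "v \<in> M - Jac"
      then have vc: "v \<in> carrier R" using sub_in by blast
      have neg: "\<ominus> x \<in> P" if "maximalideal P R" "x \<in> P" for x P
        using that additive_subgroup.a_inv_closed ideal.axioms(1) maximal_ideal by metis
      obtain P where P: "maximalideal P R" "v \<notin> P" using v vc by (auto simp: jacobson_iff)
      have "\<ominus> v \<notin> P" using neg[OF P(1), of "\<ominus> v"] P(2) vc by auto
      then show "\<ominus> v \<in> M - Jac" using neg[OF M] v P(1) by (auto simp: jacobson_iff)
      show "\<ominus> (\<ominus> v) = v" using vc by simp
      show "\<ominus> v \<noteq> v"
      proof
        assume "\<ominus> v = v"
        then have "v \<oplus> v = \<zero>" using vc by (metis r_neg)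
        moreover have "(\<one> \<oplus> \<one>) \<otimes> v = v \<oplus> v" using vc by algebra
        ultimately have "\<one> \<oplus> \<one> \<in> P"
          using maximal_prime[OF P(1), of "\<one> \<oplus> \<one>" v] maximal_zero[OF P(1)] vc P(2) by simp
        then show False using False P v by blast
      qed
    qed
    then show ?thesis by blast
  qed
qed

text \<open>The vertices are listed in layers. \<open>I\<close> stands for the intersection of
  \<open>M\<close> with the maximal ideals already treated, and \<open>T\<close> holds those still
  to come. The layer \<open>I - P\<close> is a clique for \<open>H\<close>, because the residue
  field of \<open>P\<close> has two elements, and it is put in front of a path through the rest of
  \<open>I\<close>.\<close>

lemma hamiltonian_path:
  assumes res: "\<And>P x. maximalideal P R \<Longrightarrow> x \<in> carrier R \<Longrightarrow> x \<notin> P \<Longrightarrow> \<one> \<ominus> x \<in> P"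
  shows "finite T \<Longrightarrow> (\<And>P. P \<in> T \<Longrightarrow> maximalideal P R) \<Longrightarrow> I \<subseteq> M \<Longrightarrow>
    (\<And>x y. x \<in> I \<Longrightarrow> y \<in> I \<Longrightarrow> x \<oplus> y \<in> I) \<Longrightarrow>
    (\<And>x. x \<in> I \<Longrightarrow> (\<And>P. P \<in> T \<Longrightarrow> x \<in> P) \<Longrightarrow> x \<in> Jac) \<Longrightarrow>
    \<exists>vs. distinct vs \<and> set vs = I - Jac \<and> successively H vs"
proof (induction T arbitrary: I rule: finite_induct)
  case empty
  then have "I - Jac = {}" by blast
  then show ?case by (intro exI[of _ "[]"]) simp
next
  case (insert P T)
  have P: "maximalideal P R" using insert.prems(1) by simp
  have HQ: "H x y" if "x \<in> M" "y \<in> M" "x \<notin> Q" "y \<notin> Q" "maximalideal Q R" for x y Q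
    using that residue_two[OF _ _ that(5)] res[OF that(5)] sub_in by (auto simp: H_def)
  have "\<exists>vs. distinct vs \<and> set vs = (I \<inter> P) - Jac \<and> successively H vs"
  proof (rule insert.IH)
    show "maximalideal Q R" if "Q \<in> T" for Q using insert.prems(1) that by simp
    show "I \<inter> P \<subseteq> M" using insert.prems(2) by blast
    show "x \<oplus> y \<in> I \<inter> P" if "x \<in> I \<inter> P" "y \<in> I \<inter> P" for x y
      using that insert.prems(3) maximal_add[OF P] by blast
    show "x \<in> Jac" if "x \<in> I \<inter> P" "\<And>Q. Q \<in> T \<Longrightarrow> x \<in> Q" for x
      using that insert.prems(4)[of x] by blast
  qed
  then obtain vs where vs: "distinct vs" "set vs = (I \<inter> P) - Jac" "successively H vs" by blast
  define A where "A = I - P"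
  have IJ: "I - Jac = A \<union> ((I \<inter> P) - Jac)" using P by (auto simp: A_def jacobson_iff)
  have AM: "A \<subseteq> M" using insert.prems(2) by (auto simp: A_def)
  have fA: "finite A" using AM sub_in fin by (meson finite_subset subsetI)
  have HA: "H x y" if "x \<in> A" "y \<in> A" for x y
    using HQ[OF _ _ _ _ P] that AM by (auto simp: A_def)
  have sucA: "successively H zs" if "set zs \<subseteq> A" for zs
    using that
  proof (induction zs)
    case (Cons z zs)
    then show ?case using HA[of z "hd zs"] hd_in_set[of zs] by (auto simp: successively_Cons simp del: hd_in_set)
  qed simp
  show ?case
  proof (cases "A = {} \<or> vs = []")
    case True
    then show ?thesis
    proof
      assume "A = {}" then show ?thesis using vs IJ by auto
    next
      assume "vs = []"
      obtain zs where "set zs = A" "distinct zs" using finite_distinct_list[OF fA] by blast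
      then show ?thesis using sucA vs \<open>vs = []\<close> IJ by (intro exI[of _ zs]) auto
    qed
  next
    case False
    then have u: "hd vs \<in> I" "hd vs \<in> P" "hd vs \<notin> Jac" using vs(2) hd_in_set[of vs] by auto
    have uM: "hd vs \<in> M" using u insert.prems(2) by blast
    then obtain Q where Q: "maximalideal Q R" "hd vs \<notin> Q"
      using u(3) sub_in(1) jacobson_iff by metis
    obtain y where y: "y \<in> A" using False by blast
    \<comment> \<open>The layer needs a vertex joined to \<open>hd vs\<close> by an ideal
      \<open>Q\<close> that misses \<open>hd vs\<close>. If \<open>y\<close> lies in
      \<open>Q\<close>, then \<open>hd vs \<oplus> y\<close> does not, and it is still outside
      \<open>P\<close> because \<open>hd vs\<close> is in \<open>P\<close>.\<close>
    have "\<exists>x\<in>A. x \<notin> Q"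
    proof (cases "y \<in> Q")
      case True
      have yc: "y \<in> carrier R" "hd vs \<in> carrier R" using y AM uM sub_in by blast+
      have "(hd vs \<oplus> y) \<ominus> y = hd vs" "(hd vs \<oplus> y) \<ominus> hd vs = y" using yc by algebra+
      then have "hd vs \<oplus> y \<notin> Q" "hd vs \<oplus> y \<notin> P"
        using maximal_minus[OF Q(1) _ True, of "hd vs \<oplus> y"] Q(2)
          maximal_minus[OF P _ u(2), of "hd vs \<oplus> y"] y unfolding A_def by auto
      moreover have "hd vs \<oplus> y \<in> I" using insert.prems(3)[OF u(1), of y] y unfolding A_def by blast
      ultimately show ?thesis unfolding A_def by blast
    qed (use y in blast)
    then obtain x where x: "x \<in> A" "x \<notin> Q" by blast
    obtain zs where zs: "set zs = A - {x}" "distinct zs"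
      using finite_distinct_list[of "A - {x}"] fA by blast
    have "H x (hd vs)" using HQ[OF _ uM x(2) Q(2,1)] x AM by blast
    moreover have "successively H (zs @ [x])" using sucA zs x by simp
    ultimately have "successively H ((zs @ [x]) @ vs)"
      using vs(3) by (subst successively_append_iff) simp
    moreover have "set ((zs @ [x]) @ vs) = I - Jac" using zs x vs IJ by auto
    moreover have "distinct ((zs @ [x]) @ vs)" using zs x vs by (auto simp: A_def)
    ultimately show ?thesis by blast
  qed
qed

lemma pancyclic_residue_fields_two:
  assumes res: "\<And>P x. maximalideal P R \<Longrightarrow> x \<in> carrier R \<Longrightarrow> x \<notin> P \<Longrightarrow> \<one> \<ominus> x \<in> P"
  shows "pancyclic_on edge (carrier R - Jac)"
proof -
  have "\<exists>vs. distinct vs \<and> set vs = M - Jac \<and> successively H vs"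
  proof (rule hamiltonian_path[OF res])
    have "{P. maximalideal P R} \<subseteq> Pow (carrier R)" using maximal_sub by blast
    then show "finite {P. maximalideal P R}" using fin finite_subset by blast
    show "x \<oplus> y \<in> M" if "x \<in> M" "y \<in> M" for x y using maximal_add[OF M that] .
    show "x \<in> Jac" if "x \<in> M" "\<And>P. P \<in> {P. maximalideal P R} \<Longrightarrow> x \<in> P" for x
      using that(2) sub_in(1)[OF that(1)] jacobson_iff by blast
  qed auto
  then obtain vs where vs: "distinct vs" "set vs = M - Jac" "successively H vs" by blast
  show ?thesis
  proof (rule pancyclic_transfer, rule co.pancyclic_trivial[OF _ _ vs])
    show "co.units = {}" using unit_coset res[OF M] by blast
    show "H v v" if v: "v \<in> M - Jac" for v
    proof -
      have vc: "v \<in> carrier R" using v sub_in by blast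
      then obtain P where "maximalideal P R" "v \<notin> P" using v by (auto simp: jacobson_iff)
      then show ?thesis using residue_two[OF vc vc] res[of P v] vc v by (auto simp: H_def)
    qed
  qed
qed

end

theorem corollary2p3:
  fixes R (structure)
  assumes "cring R"
    and "\<one> \<noteq> \<zero>"
    and "finite (carrier R)"
    and "\<not> local_ring R"
  shows "hamiltonian (jacobson_graph R) \<longleftrightarrow> pancyclic (jacobson_graph R)"
proof -
  interpret cring R by fact
  interpret finite_cring R using assms by unfold_locales
  show ?thesis
  proof
    assume ham: "hamiltonian (jacobson_graph R)"
    have at: "finite_cring_at R M" if "maximalideal M R" for M
      by (intro finite_cring_at.intro finite_cring_at_axioms.intro finite_cring_axioms that
          two_le_card_of_hamiltonian[OF assms(4) ham that])
    have "pancyclic_on edge (carrier R - jacobson_radical R)"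
    \<comment> \<open>The order of the cases matters: once this one fails, every residue field of
      even characteristic has two elements, as the remaining cases assume.\<close>
    proof (cases "\<exists>M x. maximalideal M R \<and> \<one> \<oplus> \<one> \<in> M \<and> x \<in> carrier R \<and> x \<notin> M \<and> \<one> \<ominus> x \<notin> M")
      case True
      then show ?thesis using finite_cring_at.pancyclic_even_characteristic[OF at] by blast
    next
      case no_even: False
      show ?thesis
      proof (cases "\<exists>M. maximalideal M R \<and> \<one> \<oplus> \<one> \<notin> M")
        case True
        then obtain M where M: "maximalideal M R" "\<one> \<oplus> \<one> \<notin> M" by blast
        show ?thesis
          by (rule finite_cring_at.pancyclic_odd_characteristic[OF at[OF M(1)] M(2)])
            (use no_even in blast)
      next
        case False
        obtain M where M: "maximalideal M R" using ex_maximal by blast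
        show ?thesis
          by (rule finite_cring_at.pancyclic_residue_fields_two[OF at[OF M]]) (use False no_even in blast)
      qed
    qed
    then show "pancyclic (jacobson_graph R)" by (rule pancyclic_of_pancyclic_on)
  next
    assume "pancyclic (jacobson_graph R)"
    then show "hamiltonian (jacobson_graph R)" by (rule hamiltonian_of_pancyclic[OF assms(4)])
  qed
qed

end
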